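(* Let $A\,|\,B\,|\,C$ be a right depth three tower of rings, and let $P=(A\otimes_B A)^C$, $Q=(A\otimes_C A)^B$, $T=(A\otimes_B A)^B$, $U=(A\otimes_C A)^C$. The bimodules ${}_TP_U$ and ${}_UQ_T$ over the rings $T$ and $U$ form a Morita context with associative multiplications $$P\otimes_U Q\to T,\quad p\otimes q\mapsto pq=q^1p^1\otimes_B p^2q^2,$$ $$Q\otimes_T P\to U,\quad q\otimes p\mapsto qp=p^1q^1\otimes_C q^2p^2 .$$ If $B\,|\,C$ is an H-separable extension, then $T$ and $U$ are Morita equivalent rings via this context.
   Context: Rings have identity; a tower of rings $A\,|\,B\,|\,C$ is a pair of unital ring homomorphisms $C\to B\to A$, inducing natural bimodule structures. The tower is right depth three if for some positive integer $N$, $A\otimes_B A$ is isomorphic, as an $A$-$C$-bimodule, to a direct summand of $A^N$. For a bimodule $M$ over a ring $R$, $M^R=\{m\in M: rm=mr\ \forall r\in R\}$. Elements of $A\otimes_B A$ or $A\otimes_C A$ are written $p=p^1\otimes p^2$ with a finite summation suppressed. Ring structures on $T$ and $U$: $tt'={t'}^1t^1\otimes_B t^2{t'}^2$, $uu'={u'}^1u^1\otimes_C u^2{u'}^2$, with identities $1_T=1_A\otimes_B 1_A$ and $1_U=1_A\otimes_C1_A$. Bimodule structures: ${}_TP_U$ by $t\cdot p\cdot u=u^1p^1t^1\otimes_B t^2p^2u^2$, and ${}_UQ_T$ by $u\cdot q\cdot t=t^1q^1u^1\otimes_C u^2q^2t^2$. A ring extension $B\,|\,C$ is H-separable if for some positive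 integer $N$, $B\otimes_C B$ is isomorphic, as a $B$-$B$-bimodule, to a direct summand of $B^N$. A Morita context is a pair of rings $T,U$ with bimodules ${}_TP_U$, ${}_UQ_T$ and bimodule maps $P\otimes_U Q\to T$, $Q\otimes_T P\to U$ satisfying $p(qp')=(pq)p'$ and $q(pq')=(qp)q'$; $T$ and $U$ are Morita equivalent via the context when these maps are isomorphisms. *)

theory Defs
  imports "HOL-Algebra.Algebra"
begin

section \<open>Bimodules over noncommutative rings\<close>

text \<open>As for the library's record of modules over commutative rings, the additive group is carried
  by the ring fields; the fields for multiplication and one are never used.\<close>

record ('r, 's, 'x) bimodule = "'x ring" +
  lact :: "'r \<Rightarrow> 'x \<Rightarrow> 'x"
  ract :: "'x \<Rightarrow> 's \<Rightarrow> 'x"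

locale bimodule = R?: ring R + S?: ring S + M?: abelian_group M
  for R :: "('r, 'i) ring_scheme" (structure) and S :: "('s, 'j) ring_scheme" (structure)
    and M :: "('r, 's, 'x) bimodule" (structure) +
  assumes lact_closed: "\<lbrakk>r \<in> carrier R; x \<in> carrier M\<rbrakk> \<Longrightarrow> lact M r x \<in> carrier M"
    and ract_closed: "\<lbrakk>x \<in> carrier M; s \<in> carrier S\<rbrakk> \<Longrightarrow> ract M x s \<in> carrier M"
    and lact_add_right: "\<lbrakk>r \<in> carrier R; x \<in> carrier M; y \<in> carrier M\<rbrakk>
      \<Longrightarrow> lact M r (x \<oplus>\<^bsub>M\<^esub> y) = lact M r x \<oplus>\<^bsub>M\<^esub> lact M r y"
    and lact_add_left: "\<lbrakk>r \<in> carrier R; r' \<in> carrier R; x \<in> carrier M\<rbrakk>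
      \<Longrightarrow> lact M (r \<oplus>\<^bsub>R\<^esub> r') x = lact M r x \<oplus>\<^bsub>M\<^esub> lact M r' x"
    and ract_add_left: "\<lbrakk>x \<in> carrier M; y \<in> carrier M; s \<in> carrier S\<rbrakk>
      \<Longrightarrow> ract M (x \<oplus>\<^bsub>M\<^esub> y) s = ract M x s \<oplus>\<^bsub>M\<^esub> ract M y s"
    and ract_add_right: "\<lbrakk>x \<in> carrier M; s \<in> carrier S; s' \<in> carrier S\<rbrakk>
      \<Longrightarrow> ract M x (s \<oplus>\<^bsub>S\<^esub> s') = ract M x s \<oplus>\<^bsub>M\<^esub> ract M x s'"
    and lact_mult: "\<lbrakk>r \<in> carrier R; r' \<in> carrier R; x \<in> carrier M\<rbrakk>
      \<Longrightarrow> lact M (r \<otimes>\<^bsub>R\<^esub> r') x = lact M r (lact M r' x)"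
    and ract_mult: "\<lbrakk>x \<in> carrier M; s \<in> carrier S; s' \<in> carrier S\<rbrakk>
      \<Longrightarrow> ract M x (s \<otimes>\<^bsub>S\<^esub> s') = ract M (ract M x s) s'"
    and lact_one: "x \<in> carrier M \<Longrightarrow> lact M \<one>\<^bsub>R\<^esub> x = x"
    and ract_one: "x \<in> carrier M \<Longrightarrow> ract M x \<one>\<^bsub>S\<^esub> = x"
    and lact_ract: "\<lbrakk>r \<in> carrier R; x \<in> carrier M; s \<in> carrier S\<rbrakk>
      \<Longrightarrow> ract M (lact M r x) s = lact M r (ract M x s)"

definition bimodule_hom ::
  "('r, 'i) ring_scheme \<Rightarrow> ('s, 'j) ring_scheme \<Rightarrow> ('r, 's, 'x) bimodule \<Rightarrow> ('r, 's, 'y) bimodule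
    \<Rightarrow> ('x \<Rightarrow> 'y) set" where
  "bimodule_hom R S M N = {\<phi> \<in> carrier M \<rightarrow> carrier N.
     (\<forall>x \<in> carrier M. \<forall>y \<in> carrier M. \<phi> (x \<oplus>\<^bsub>M\<^esub> y) = \<phi> x \<oplus>\<^bsub>N\<^esub> \<phi> y) \<and>
     (\<forall>r \<in> carrier R. \<forall>x \<in> carrier M. \<phi> (lact M r x) = lact N r (\<phi> x)) \<and>
     (\<forall>x \<in> carrier M. \<forall>s \<in> carrier S. \<phi> (ract M x s) = ract N (\<phi> x) s)}"

definition bimodule_iso ::
  "('r, 'i) ring_scheme \<Rightarrow> ('s, 'j) ring_scheme \<Rightarrow> ('r, 's, 'x) bimodule \<Rightarrow> ('r, 's, 'y) bimodule
    \<Rightarrow> ('x \<Rightarrow> 'y) set" where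
  "bimodule_iso R S M N = {\<phi> \<in> bimodule_hom R S M N. bij_betw \<phi> (carrier M) (carrier N)}"

definition subbimodule ::
  "('r, 'i) ring_scheme \<Rightarrow> ('s, 'j) ring_scheme \<Rightarrow> 'x set \<Rightarrow> ('r, 's, 'x) bimodule \<Rightarrow> bool" where
  "subbimodule R S D M \<longleftrightarrow> additive_subgroup D M \<and>
     (\<forall>r \<in> carrier R. \<forall>x \<in> D. lact M r x \<in> D) \<and> (\<forall>x \<in> D. \<forall>s \<in> carrier S. ract M x s \<in> D)"

definition direct_summand ::
  "('r, 'i) ring_scheme \<Rightarrow> ('s, 'j) ring_scheme \<Rightarrow> 'x set \<Rightarrow> ('r, 's, 'x) bimodule \<Rightarrow> bool" where
  "direct_summand R S D M \<longleftrightarrow> subbimodule R S D M \<and>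
     (\<exists>E. subbimodule R S E M \<and> D \<inter> E = {\<zero>\<^bsub>M\<^esub>} \<and> D <+>\<^bsub>M\<^esub> E = carrier M)"

definition iso_to_direct_summand ::
  "('r, 'i) ring_scheme \<Rightarrow> ('s, 'j) ring_scheme \<Rightarrow> ('r, 's, 'x) bimodule \<Rightarrow> ('r, 's, 'y) bimodule
    \<Rightarrow> bool" where
  "iso_to_direct_summand R S L M \<longleftrightarrow>
     (\<exists>D. direct_summand R S D M \<and> bimodule_iso R S L (M\<lparr>carrier := D\<rparr>) \<noteq> {})"

definition regular_bimodule :: "('r, 'i) ring_scheme \<Rightarrow> ('r, 'r, 'r) bimodule" where
  "regular_bimodule R = \<lparr>carrier = carrier R,
     monoid.mult = undefined, monoid.one = undefined,
     ring.zero = \<zero>\<^bsub>R\<^esub>, ring.add = ring.add R, lact = monoid.mult R, ract = monoid.mult R\<rparr>"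

definition restrict_scalars ::
  "('p \<Rightarrow> 'r) \<Rightarrow> ('q \<Rightarrow> 's) \<Rightarrow> ('r, 's, 'x) bimodule \<Rightarrow> ('p, 'q, 'x) bimodule" where
  "restrict_scalars \<rho> \<sigma> M = \<lparr>carrier = carrier M,
     monoid.mult = undefined, monoid.one = undefined,
     ring.zero = \<zero>\<^bsub>M\<^esub>, ring.add = ring.add M,
     lact = (\<lambda>r. lact M (\<rho> r)), ract = (\<lambda>x s. ract M x (\<sigma> s))\<rparr>"

definition bimodule_power :: "nat \<Rightarrow> ('r, 's, 'x) bimodule \<Rightarrow> ('r, 's, nat \<Rightarrow> 'x) bimodule" where
  "bimodule_power N M = \<lparr>carrier = {..<N} \<rightarrow>\<^sub>E carrier M,
     monoid.mult = undefined, monoid.one = undefined,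
     ring.zero = (\<lambda>i\<in>{..<N}. \<zero>\<^bsub>M\<^esub>), ring.add = (\<lambda>x y. \<lambda>i\<in>{..<N}. x i \<oplus>\<^bsub>M\<^esub> y i),
     lact = (\<lambda>r x. \<lambda>i\<in>{..<N}. lact M r (x i)), ract = (\<lambda>x s. \<lambda>i\<in>{..<N}. ract M (x i) s)\<rparr>"

definition centralizer :: "('r, 'i) ring_scheme \<Rightarrow> ('r, 'r, 'x) bimodule \<Rightarrow> 'x set" where
  "centralizer R M = {m \<in> carrier M. \<forall>r \<in> carrier R. lact M r m = ract M m r}"


section \<open>Tensor products\<close>

text \<open>The tensor product of \<open>M\<close> and \<open>N\<close> over \<open>R\<close> is the free abelian group on pairs modulo
  biadditivity and \<open>R\<close>-balancedness, so its elements are cosets of formal integer combinations.\<close>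

definition tensor_relations ::
  "('r, 'i) ring_scheme \<Rightarrow> ('l, 'r, 'x) bimodule \<Rightarrow> ('r, 's, 'y) bimodule
    \<Rightarrow> (('x \<times> 'y) \<Rightarrow>\<^sub>0 int) set" where
  "tensor_relations R M N =
     {frag_of (m \<oplus>\<^bsub>M\<^esub> m', n) - frag_of (m, n) - frag_of (m', n) | m m' n.
        m \<in> carrier M \<and> m' \<in> carrier M \<and> n \<in> carrier N} \<union>
     {frag_of (m, n \<oplus>\<^bsub>N\<^esub> n') - frag_of (m, n) - frag_of (m, n') | m n n'.
        m \<in> carrier M \<and> n \<in> carrier N \<and> n' \<in> carrier N} \<union>
     {frag_of (ract M m r, n) - frag_of (m, lact N r n) | m r n.
        m \<in> carrier M \<and> r \<in> carrier R \<and> n \<in> carrier N}"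

definition free_pairs ::
  "('l, 'r, 'x) bimodule \<Rightarrow> ('r, 's, 'y) bimodule \<Rightarrow> (('x \<times> 'y) \<Rightarrow>\<^sub>0 int) monoid" where
  "free_pairs M N = free_Abelian_group (carrier M \<times> carrier N)"

definition tensor_kernel ::
  "('r, 'i) ring_scheme \<Rightarrow> ('l, 'r, 'x) bimodule \<Rightarrow> ('r, 's, 'y) bimodule
    \<Rightarrow> (('x \<times> 'y) \<Rightarrow>\<^sub>0 int) set" where
  "tensor_kernel R M N = generate (free_pairs M N) (tensor_relations R M N)"

definition tensor_group ::
  "('r, 'i) ring_scheme \<Rightarrow> ('l, 'r, 'x) bimodule \<Rightarrow> ('r, 's, 'y) bimodule
    \<Rightarrow> (('x \<times> 'y) \<Rightarrow>\<^sub>0 int) set ring" where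
  "tensor_group R M N = (let G = free_pairs M N Mod tensor_kernel R M N in
     \<lparr>carrier = carrier G,
     monoid.mult = undefined, monoid.one = undefined,
      ring.zero = monoid.one G, ring.add = monoid.mult G\<rparr>)"

definition pure_tensor ::
  "('r, 'i) ring_scheme \<Rightarrow> ('l, 'r, 'x) bimodule \<Rightarrow> ('r, 's, 'y) bimodule \<Rightarrow> 'x \<Rightarrow> 'y
    \<Rightarrow> (('x \<times> 'y) \<Rightarrow>\<^sub>0 int) set" where
  "pure_tensor R M N m n = tensor_kernel R M N #>\<^bsub>free_pairs M N\<^esub> frag_of (m, n)"

text \<open>\<open>tensor_lift G h\<close> is the additive map into \<open>G\<close> with \<open>m \<otimes> n \<mapsto> h m n\<close>. For balanced \<open>h\<close>
  all representatives of a coset have the same value, which \<open>the_elem\<close> selects; see the lemmas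
  below.\<close>

definition free_extension ::
  "('z, 'i) ring_scheme \<Rightarrow> ('x \<Rightarrow> 'y \<Rightarrow> 'z) \<Rightarrow> (('x \<times> 'y) \<Rightarrow>\<^sub>0 int) \<Rightarrow> 'z" where
  "free_extension G h c =
     (\<Oplus>\<^bsub>G\<^esub>k \<in> Poly_Mapping.keys c. add_pow G (Poly_Mapping.lookup c k) (h (fst k) (snd k)))"

definition tensor_lift ::
  "('z, 'i) ring_scheme \<Rightarrow> ('x \<Rightarrow> 'y \<Rightarrow> 'z) \<Rightarrow> (('x \<times> 'y) \<Rightarrow>\<^sub>0 int) set \<Rightarrow> 'z" where
  "tensor_lift G h L = the_elem (free_extension G h ` L)"

definition tensor ::
  "('r, 'i) ring_scheme \<Rightarrow> ('l, 'r, 'x) bimodule \<Rightarrow> ('r, 's, 'y) bimodule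
    \<Rightarrow> ('l, 's, (('x \<times> 'y) \<Rightarrow>\<^sub>0 int) set) bimodule" where
  "tensor R M N = (let G = tensor_group R M N in
     \<lparr>carrier = carrier G,
     monoid.mult = undefined, monoid.one = undefined,
      ring.zero = \<zero>\<^bsub>G\<^esub>, ring.add = ring.add G,
      lact = (\<lambda>l. tensor_lift G (\<lambda>m n. pure_tensor R M N (lact M l m) n)),
      ract = (\<lambda>x s. tensor_lift G (\<lambda>m n. pure_tensor R M N m (ract N n s)) x)\<rparr>)"

definition balanced ::
  "('r, 'i) ring_scheme \<Rightarrow> ('l, 'r, 'x) bimodule \<Rightarrow> ('r, 's, 'y) bimodule \<Rightarrow> ('z, 'j) ring_scheme
    \<Rightarrow> ('x \<Rightarrow> 'y \<Rightarrow> 'z) \<Rightarrow> bool" where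
  "balanced R M N G h \<longleftrightarrow>
     (\<forall>m \<in> carrier M. \<forall>n \<in> carrier N. h m n \<in> carrier G) \<and>
     (\<forall>m \<in> carrier M. \<forall>m' \<in> carrier M. \<forall>n \<in> carrier N. h (m \<oplus>\<^bsub>M\<^esub> m') n = h m n \<oplus>\<^bsub>G\<^esub> h m' n) \<and>
     (\<forall>m \<in> carrier M. \<forall>n \<in> carrier N. \<forall>n' \<in> carrier N. h m (n \<oplus>\<^bsub>N\<^esub> n') = h m n \<oplus>\<^bsub>G\<^esub> h m n') \<and>
     (\<forall>m \<in> carrier M. \<forall>r \<in> carrier R. \<forall>n \<in> carrier N. h (ract M m r) n = h m (lact N r n))"

lemma free_extension_hom:
  assumes G: "abelian_group G" and h: "\<And>m n. m \<in> L \<Longrightarrow> n \<in> L' \<Longrightarrow> h m n \<in> carrier G"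
  shows "free_extension G h \<in> hom (free_Abelian_group (L \<times> L')) (add_monoid G)"
proof (rule homI)
  interpret abelian_group G by (rule G)
  have cl: "add_pow G i (h (fst k) (snd k)) \<in> carrier G" if "k \<in> L \<times> L'" for k and i :: int
    using that h by (auto intro!: add.int_pow_closed)
  have zero: "add_pow G (0::int) x = \<zero>\<^bsub>G\<^esub>" for x
    by (simp add: add_pow_def)
  have ext: "free_extension G h c
      = (\<Oplus>\<^bsub>G\<^esub>k \<in> K. add_pow G (Poly_Mapping.lookup c k) (h (fst k) (snd k)))"
    if "finite K" "Poly_Mapping.keys c \<subseteq> K" "K \<subseteq> L \<times> L'" for c K
    unfolding free_extension_def
    by (rule add.finprod_mono_neutral_cong_left)
      (use that cl in \<open>auto simp: in_keys_iff Pi_iff subset_iff zero\<close>)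
  fix c d assume c: "c \<in> carrier (free_Abelian_group (L \<times> L'))"
    and d: "d \<in> carrier (free_Abelian_group (L \<times> L'))"
  let ?K = "Poly_Mapping.keys c \<union> Poly_Mapping.keys d"
  have K: "finite ?K" "?K \<subseteq> L \<times> L'" "Poly_Mapping.keys (c + d) \<subseteq> ?K"
    using c d keys_add[of c d] by auto
  have "(\<Oplus>\<^bsub>G\<^esub>k \<in> ?K. add_pow G (Poly_Mapping.lookup (c + d) k) (h (fst k) (snd k)))
      = (\<Oplus>\<^bsub>G\<^esub>k \<in> ?K. add_pow G (Poly_Mapping.lookup c k) (h (fst k) (snd k))
          \<oplus>\<^bsub>G\<^esub> add_pow G (Poly_Mapping.lookup d k) (h (fst k) (snd k)))"
    by (rule add.finprod_cong')
      (use K cl h in \<open>auto simp: lookup_add add.int_pow_mult Pi_iff subset_iff\<close>)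
  also have "\<dots> = (\<Oplus>\<^bsub>G\<^esub>k \<in> ?K. add_pow G (Poly_Mapping.lookup c k) (h (fst k) (snd k)))
      \<oplus>\<^bsub>G\<^esub> (\<Oplus>\<^bsub>G\<^esub>k \<in> ?K. add_pow G (Poly_Mapping.lookup d k) (h (fst k) (snd k)))"
    by (rule add.finprod_multf) (use K cl in \<open>auto simp: Pi_iff subset_iff\<close>)
  finally show "free_extension G h (c \<otimes>\<^bsub>free_Abelian_group (L \<times> L')\<^esub> d)
      = free_extension G h c \<otimes>\<^bsub>add_monoid G\<^esub> free_extension G h d"
    using ext[of ?K c] ext[of ?K d] ext[of ?K "c + d"] K by simp
next
  interpret abelian_group G by (rule G)
  fix c assume "c \<in> carrier (free_Abelian_group (L \<times> L'))"
  then show "free_extension G h c \<in> carrier (add_monoid G)"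
    unfolding free_extension_def using h
    by (auto intro!: add.finprod_closed add.int_pow_closed simp: Pi_iff subset_iff)
qed

lemma free_extension_frag_of:
  assumes "abelian_group G" "h m n \<in> carrier G"
  shows "free_extension G h (frag_of (m, n)) = h m n"
proof -
  interpret abelian_group G by fact
  show ?thesis using assms(2) by (simp add: free_extension_def add.int_pow_1)
qed

lemma balanced_kernel:
  assumes M: "abelian_group M" and N: "abelian_group N" and G: "abelian_group G"
    and h: "balanced R M N G h"
    and ract: "\<And>m r. m \<in> carrier M \<Longrightarrow> r \<in> carrier R \<Longrightarrow> ract M m r \<in> carrier M"
    and lact: "\<And>r n. r \<in> carrier R \<Longrightarrow> n \<in> carrier N \<Longrightarrow> lact N r n \<in> carrier N"
  shows "tensor_relations R M N \<subseteq> carrier (free_pairs M N)"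
    and "z \<in> tensor_kernel R M N \<Longrightarrow> free_extension G h z = \<zero>\<^bsub>G\<^esub>"
proof -
  interpret M: abelian_group M by (rule M)
  interpret N: abelian_group N by (rule N)
  interpret G: abelian_group G by (rule G)
  let ?F = "free_pairs M N"
  have hc: "\<And>m n. m \<in> carrier M \<Longrightarrow> n \<in> carrier N \<Longrightarrow> h m n \<in> carrier G"
    using h by (simp add: balanced_def)
  interpret H: group_hom ?F "add_monoid G" "free_extension G h"
    unfolding free_pairs_def
    by (intro group_hom.intro group_hom_axioms.intro free_extension_hom G hc) auto
  have frag: "frag_of (m, n) \<in> carrier ?F" if "m \<in> carrier M" "n \<in> carrier N" for m n
    using that by (simp add: free_pairs_def)
  have minus: "c - d \<in> carrier ?F \<and> free_extension G h (c - d)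
      = free_extension G h c \<ominus>\<^bsub>G\<^esub> free_extension G h d"
    if "c \<in> carrier ?F" "d \<in> carrier ?F" for c d
  proof -
    have "inv\<^bsub>?F\<^esub> d = - d" using that by (simp add: free_pairs_def)
    then have e: "c - d = c \<otimes>\<^bsub>?F\<^esub> inv\<^bsub>?F\<^esub> d" by (simp add: free_pairs_def)
    show ?thesis
      unfolding e using that H.hom_mult[of c "inv\<^bsub>?F\<^esub> d"] H.hom_inv[of d]
      by (simp add: a_minus_def a_inv_def)
  qed
  note ev = free_extension_frag_of[of G h, OF G hc]
  have cancel: "(x \<oplus>\<^bsub>G\<^esub> y) \<ominus>\<^bsub>G\<^esub> x \<ominus>\<^bsub>G\<^esub> y = \<zero>\<^bsub>G\<^esub>" if "x \<in> carrier G" "y \<in> carrier G" for x y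
    using that by (simp add: a_minus_def G.a_comm[of x y] G.a_assoc G.r_neg)
  have cancel2: "x \<ominus>\<^bsub>G\<^esub> x = \<zero>\<^bsub>G\<^esub>" if "x \<in> carrier G" for x
    using that by (simp add: a_minus_def G.r_neg)
  have bal1: "h (m \<oplus>\<^bsub>M\<^esub> m') n = h m n \<oplus>\<^bsub>G\<^esub> h m' n"
    if "m \<in> carrier M" "m' \<in> carrier M" "n \<in> carrier N" for m m' n
    using h that unfolding balanced_def by blast
  have bal2: "h m (n \<oplus>\<^bsub>N\<^esub> n') = h m n \<oplus>\<^bsub>G\<^esub> h m n'"
    if "m \<in> carrier M" "n \<in> carrier N" "n' \<in> carrier N" for m n n'
    using h that unfolding balanced_def by blast
  have bal3: "h (ract M m r) n = h m (lact N r n)"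
    if "m \<in> carrier M" "r \<in> carrier R" "n \<in> carrier N" for m r n
    using h that unfolding balanced_def by blast
  have rel: "tensor_relations R M N \<subseteq> {c \<in> carrier ?F. free_extension G h c = \<zero>\<^bsub>G\<^esub>}"
  proof
    have diff: "c - a - b \<in> carrier ?F \<and> free_extension G h (c - a - b)
        = free_extension G h c \<ominus>\<^bsub>G\<^esub> free_extension G h a \<ominus>\<^bsub>G\<^esub> free_extension G h b"
      if "c \<in> carrier ?F" "a \<in> carrier ?F" "b \<in> carrier ?F" for a b c
      using minus[of c a] minus[of "c - a" b] that by simp
    fix c assume "c \<in> tensor_relations R M N"
    then consider
      m m' n where "c = frag_of (m \<oplus>\<^bsub>M\<^esub> m', n) - frag_of (m, n) - frag_of (m', n)"
        "m \<in> carrier M" "m' \<in> carrier M" "n \<in> carrier N"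
      | m n n' where "c = frag_of (m, n \<oplus>\<^bsub>N\<^esub> n') - frag_of (m, n) - frag_of (m, n')"
        "m \<in> carrier M" "n \<in> carrier N" "n' \<in> carrier N"
      | m r n where "c = frag_of (ract M m r, n) - frag_of (m, lact N r n)"
        "m \<in> carrier M" "r \<in> carrier R" "n \<in> carrier N"
      unfolding tensor_relations_def by blast
    then show "c \<in> {c \<in> carrier ?F. free_extension G h c = \<zero>\<^bsub>G\<^esub>}"
    proof cases
      case 1
      have "free_extension G h c = \<zero>\<^bsub>G\<^esub>"
        unfolding 1(1) diff[OF frag frag frag, OF M.a_closed[OF 1(2,3)] 1(4) 1(2,4,3,4), THEN conjunct2]
          ev[OF M.a_closed[OF 1(2,3)] 1(4)] ev[OF 1(2,4)] ev[OF 1(3,4)]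
          bal1[OF 1(2-4)]
        by (rule cancel[OF hc[OF 1(2,4)] hc[OF 1(3,4)]])
      then show ?thesis
        using diff[OF frag frag frag, OF M.a_closed[OF 1(2,3)] 1(4) 1(2,4,3,4), THEN conjunct1] 1(1)
        by blast
    next
      case 2
      have "free_extension G h c = \<zero>\<^bsub>G\<^esub>"
        unfolding 2(1) diff[OF frag frag frag, OF 2(2) N.a_closed[OF 2(3,4)] 2(2,3,2,4), THEN conjunct2]
          ev[OF 2(2) N.a_closed[OF 2(3,4)]] ev[OF 2(2,3)] ev[OF 2(2,4)]
          bal2[OF 2(2-4)]
        by (rule cancel[OF hc[OF 2(2,3)] hc[OF 2(2,4)]])
      then show ?thesis
        using diff[OF frag frag frag, OF 2(2) N.a_closed[OF 2(3,4)] 2(2,3,2,4), THEN conjunct1] 2(1)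
        by blast
    next
      case 3
      have "free_extension G h c = \<zero>\<^bsub>G\<^esub>"
        unfolding 3(1) minus[OF frag frag, OF ract[OF 3(2,3)] 3(4,2) lact[OF 3(3,4)], THEN conjunct2]
          ev[OF ract[OF 3(2,3)] 3(4)] ev[OF 3(2) lact[OF 3(3,4)]]
          bal3[OF 3(2-4)]
        by (rule cancel2[OF hc[OF 3(2) lact[OF 3(3,4)]]])
      then show ?thesis
        using minus[OF frag frag, OF ract[OF 3(2,3)] 3(4,2) lact[OF 3(3,4)], THEN conjunct1] 3(1)
        by blast
    qed
  qed
  then show rc: "tensor_relations R M N \<subseteq> carrier ?F" by auto
  have "tensor_kernel R M N \<subseteq> kernel ?F (add_monoid G) (free_extension G h)"
    unfolding tensor_kernel_def
    by (rule group.generate_subgroup_incl[OF H.G.is_group _ H.subgroup_kernel])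
      (use rel in \<open>auto simp: kernel_def\<close>)
  then show "z \<in> tensor_kernel R M N \<Longrightarrow> free_extension G h z = \<zero>\<^bsub>G\<^esub>"
    by (auto simp: kernel_def)
qed

lemma tensor_lift_coset:
  assumes M: "abelian_group M" and N: "abelian_group N" and G: "abelian_group G"
    and h: "balanced R M N G h"
    and ract: "\<And>m r. m \<in> carrier M \<Longrightarrow> r \<in> carrier R \<Longrightarrow> ract M m r \<in> carrier M"
    and lact: "\<And>r n. r \<in> carrier R \<Longrightarrow> n \<in> carrier N \<Longrightarrow> lact N r n \<in> carrier N"
    and c: "c \<in> carrier (free_pairs M N)"
  shows "tensor_lift G h (tensor_kernel R M N #>\<^bsub>free_pairs M N\<^esub> c) = free_extension G h c"
proof -
  interpret G: abelian_group G by (rule G)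
  let ?F = "free_pairs M N" and ?K = "tensor_kernel R M N"
  have hc: "\<And>m n. m \<in> carrier M \<Longrightarrow> n \<in> carrier N \<Longrightarrow> h m n \<in> carrier G"
    using h by (simp add: balanced_def)
  interpret H: group_hom ?F "add_monoid G" "free_extension G h"
    unfolding free_pairs_def
    by (intro group_hom.intro group_hom_axioms.intro free_extension_hom G hc) auto
  have K1: "tensor_relations R M N \<subseteq> carrier ?F"
    by (rule balanced_kernel(1)[OF M N G h]) (fact ract lact)+
  have K2: "free_extension G h z = \<zero>\<^bsub>G\<^esub>" if "z \<in> ?K" for z
    by (rule balanced_kernel(2)[OF M N G h _ _ that]) (fact ract lact)+
  have sub: "subgroup ?K ?F"
    unfolding tensor_kernel_def by (rule H.G.generate_is_subgroup) (rule K1)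
  have "free_extension G h ` (?K #>\<^bsub>?F\<^esub> c) = {free_extension G h c}"
  proof -
    have "free_extension G h (z \<otimes>\<^bsub>?F\<^esub> c) = free_extension G h c" if "z \<in> ?K" for z
      using H.hom_mult[of z c] that c K2[OF that] subgroup.mem_carrier[OF sub that]
        H.hom_closed[OF c] by simp
    moreover obtain z where "z \<in> ?K" using subgroup.one_closed[OF sub] by blast
    ultimately show ?thesis unfolding r_coset_def by (force intro: rev_image_eqI)
  qed
  then show ?thesis by (simp add: tensor_lift_def)
qed

lemma tensor_lift_pure:
  assumes "abelian_group M" "abelian_group N" "abelian_group G" "balanced R M N G h"
    and "\<And>m r. m \<in> carrier M \<Longrightarrow> r \<in> carrier R \<Longrightarrow> ract M m r \<in> carrier M"
    and "\<And>r n. r \<in> carrier R \<Longrightarrow> n \<in> carrier N \<Longrightarrow> lact N r n \<in> carrier N"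
    and "m \<in> carrier M" "n \<in> carrier N"
  shows "tensor_lift G h (pure_tensor R M N m n) = h m n"
proof -
  have "h m n \<in> carrier G" using assms(4,7,8) by (simp add: balanced_def)
  moreover have "frag_of (m, n) \<in> carrier (free_pairs M N)"
    using assms(7,8) by (simp add: free_pairs_def)
  ultimately show ?thesis
    unfolding pure_tensor_def
    using tensor_lift_coset[OF assms(1-6)] free_extension_frag_of[OF assms(3), of h m n] by simp
qed

section \<open>Towers of rings\<close>

locale ring_tower = A?: ring A + B?: ring B + C?: ring C
  for A (structure) and B (structure) and C (structure) and \<alpha> and \<beta> +
  assumes top_hom: "\<alpha> \<in> ring_hom B A"
    and bottom_hom: "\<beta> \<in> ring_hom C B"

text \<open>For \<open>\<rho> : R \<rightarrow> A\<close>, the \<open>A\<close>-\<open>A\<close>-bimodule \<open>A \<otimes>\<^sub>R A\<close> and its elements \<open>x \<otimes>\<^sub>R y\<close>.\<close>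

definition ext_tensor ::
  "('a, 'i) ring_scheme \<Rightarrow> ('r, 'j) ring_scheme \<Rightarrow> ('r \<Rightarrow> 'a)
    \<Rightarrow> ('a, 'a, (('a \<times> 'a) \<Rightarrow>\<^sub>0 int) set) bimodule" where
  "ext_tensor A R \<rho> = tensor R (restrict_scalars id \<rho> (regular_bimodule A))
                               (restrict_scalars \<rho> id (regular_bimodule A))"

definition ext_pure ::
  "('a, 'i) ring_scheme \<Rightarrow> ('r, 'j) ring_scheme \<Rightarrow> ('r \<Rightarrow> 'a) \<Rightarrow> 'a \<Rightarrow> 'a
    \<Rightarrow> (('a \<times> 'a) \<Rightarrow>\<^sub>0 int) set" where
  "ext_pure A R \<rho> = pure_tensor R (restrict_scalars id \<rho> (regular_bimodule A))
                                  (restrict_scalars \<rho> id (regular_bimodule A))"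

definition right_depth_three ::
  "('a, 'i) ring_scheme \<Rightarrow> ('b, 'j) ring_scheme \<Rightarrow> ('c, 'k) ring_scheme \<Rightarrow> ('b \<Rightarrow> 'a) \<Rightarrow> ('c \<Rightarrow> 'b)
    \<Rightarrow> bool" where
  "right_depth_three A B C \<alpha> \<beta> \<longleftrightarrow> (\<exists>N::nat. N > 0 \<and>
     iso_to_direct_summand A C
       (restrict_scalars id (\<alpha> \<circ> \<beta>) (ext_tensor A B \<alpha>))
       (restrict_scalars id (\<alpha> \<circ> \<beta>) (bimodule_power N (regular_bimodule A))))"

definition H_separable ::
  "('b, 'i) ring_scheme \<Rightarrow> ('c, 'j) ring_scheme \<Rightarrow> ('c \<Rightarrow> 'b) \<Rightarrow> bool" where
  "H_separable B C \<beta> \<longleftrightarrow> (\<exists>N::nat. N > 0 \<and>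
     iso_to_direct_summand B B (ext_tensor B C \<beta>) (bimodule_power N (regular_bimodule B)))"

text \<open>All products and actions in the construction are instances of
  \<open>x y = y\<^sup>1 x\<^sup>1 \<otimes>\<^sub>R x\<^sup>2 y\<^sup>2\<close>, where \<open>x \<in> A \<otimes>\<^sub>R A\<close> and \<open>y \<in> A \<otimes>\<^sub>S A\<close> for possibly different rings
  \<open>R\<close> and \<open>S\<close>. The formula makes sense when \<open>x\<close> centralizes \<open>S\<close>, which holds in each instance below.
  The inner lift expands \<open>x\<close> and yields \<open>y\<^sup>1 x y\<^sup>2\<close>; the outer one expands \<open>y\<close>.\<close>

definition nested_mult ::
  "('a, 'i) ring_scheme \<Rightarrow> ('r, 'j) ring_scheme \<Rightarrow> ('r \<Rightarrow> 'a)
    \<Rightarrow> (('a \<times> 'a) \<Rightarrow>\<^sub>0 int) set \<Rightarrow> (('a \<times> 'a) \<Rightarrow>\<^sub>0 int) set \<Rightarrow> (('a \<times> 'a) \<Rightarrow>\<^sub>0 int) set" where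
  "nested_mult A R \<rho> x y =
     tensor_lift (ext_tensor A R \<rho>) (\<lambda>y1 y2.
       tensor_lift (ext_tensor A R \<rho>) (\<lambda>x1 x2. ext_pure A R \<rho> (y1 \<otimes>\<^bsub>A\<^esub> x1) (x2 \<otimes>\<^bsub>A\<^esub> y2)) x) y"

text \<open>The underlying set \<open>(A \<otimes>\<^sub>R A)\<^sup>S\<close> for \<open>\<rho> : R \<rightarrow> A\<close> and \<open>\<sigma> : S \<rightarrow> A\<close>.\<close>

definition ext_centralizer ::
  "('a, 'i) ring_scheme \<Rightarrow> ('r, 'j) ring_scheme \<Rightarrow> ('r \<Rightarrow> 'a) \<Rightarrow> ('s, 'k) ring_scheme \<Rightarrow> ('s \<Rightarrow> 'a)
    \<Rightarrow> (('a \<times> 'a) \<Rightarrow>\<^sub>0 int) set set" where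
  "ext_centralizer A R \<rho> S \<sigma> = centralizer S (restrict_scalars \<sigma> \<sigma> (ext_tensor A R \<rho>))"

text \<open>The ring \<open>(A \<otimes>\<^sub>R A)\<^sup>R\<close>, i.e. \<open>T\<close> for \<open>R = B\<close> and \<open>U\<close> for \<open>R = C\<close>.\<close>

definition centralizer_ring ::
  "('a, 'i) ring_scheme \<Rightarrow> ('r, 'j) ring_scheme \<Rightarrow> ('r \<Rightarrow> 'a) \<Rightarrow> (('a \<times> 'a) \<Rightarrow>\<^sub>0 int) set ring" where
  "centralizer_ring A R \<rho> = \<lparr>carrier = ext_centralizer A R \<rho> R \<rho>,
     monoid.mult = nested_mult A R \<rho>, monoid.one = ext_pure A R \<rho> \<one>\<^bsub>A\<^esub> \<one>\<^bsub>A\<^esub>,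
     ring.zero = \<zero>\<^bsub>ext_tensor A R \<rho>\<^esub>, ring.add = ring.add (ext_tensor A R \<rho>)\<rparr>"

text \<open>The bimodule \<open>(A \<otimes>\<^sub>R A)\<^sup>S\<close> over \<open>(A \<otimes>\<^sub>R A)\<^sup>R\<close> on the left and \<open>(A \<otimes>\<^sub>S A)\<^sup>S\<close> on the right,
  i.e. \<open>P\<close> for \<open>R, S = B, C\<close> and \<open>Q\<close> for \<open>R, S = C, B\<close>.\<close>

definition centralizer_bimodule ::
  "('a, 'i) ring_scheme \<Rightarrow> ('r, 'j) ring_scheme \<Rightarrow> ('r \<Rightarrow> 'a) \<Rightarrow> ('s, 'k) ring_scheme \<Rightarrow> ('s \<Rightarrow> 'a)
    \<Rightarrow> ((('a \<times> 'a) \<Rightarrow>\<^sub>0 int) set, (('a \<times> 'a) \<Rightarrow>\<^sub>0 int) set, (('a \<times> 'a) \<Rightarrow>\<^sub>0 int) set) bimodule" where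
  "centralizer_bimodule A R \<rho> S \<sigma> = \<lparr>carrier = ext_centralizer A R \<rho> S \<sigma>,
     monoid.mult = undefined, monoid.one = undefined,
     ring.zero = \<zero>\<^bsub>ext_tensor A R \<rho>\<^esub>, ring.add = ring.add (ext_tensor A R \<rho>),
     lact = nested_mult A R \<rho>, ract = nested_mult A R \<rho>\<rparr>"


section \<open>Morita contexts\<close>

definition morita_context ::
  "('t, 'i) ring_scheme \<Rightarrow> ('u, 'j) ring_scheme \<Rightarrow> ('t, 'u, 'p) bimodule \<Rightarrow> ('u, 't, 'q) bimodule
    \<Rightarrow> ((('p \<times> 'q) \<Rightarrow>\<^sub>0 int) set \<Rightarrow> 't) \<Rightarrow> ((('q \<times> 'p) \<Rightarrow>\<^sub>0 int) set \<Rightarrow> 'u) \<Rightarrow> bool" where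
  "morita_context T U P Q \<mu> \<nu> \<longleftrightarrow>
     ring T \<and> ring U \<and> bimodule T U P \<and> bimodule U T Q \<and>
     \<mu> \<in> bimodule_hom T T (tensor U P Q) (regular_bimodule T) \<and>
     \<nu> \<in> bimodule_hom U U (tensor T Q P) (regular_bimodule U) \<and>
     (\<forall>p \<in> carrier P. \<forall>q \<in> carrier Q. \<forall>p' \<in> carrier P.
        ract P p (\<nu> (pure_tensor T Q P q p')) = lact P (\<mu> (pure_tensor U P Q p q)) p') \<and>
     (\<forall>q \<in> carrier Q. \<forall>p \<in> carrier P. \<forall>q' \<in> carrier Q.
        ract Q q (\<mu> (pure_tensor U P Q p q')) = lact Q (\<nu> (pure_tensor T Q P q p)) q')"

definition morita_equivalent_via ::
  "('t, 'i) ring_scheme \<Rightarrow> ('u, 'j) ring_scheme \<Rightarrow> ('t, 'u, 'p) bimodule \<Rightarrow> ('u, 't, 'q) bimodule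
    \<Rightarrow> ((('p \<times> 'q) \<Rightarrow>\<^sub>0 int) set \<Rightarrow> 't) \<Rightarrow> ((('q \<times> 'p) \<Rightarrow>\<^sub>0 int) set \<Rightarrow> 'u) \<Rightarrow> bool" where
  "morita_equivalent_via T U P Q \<mu> \<nu> \<longleftrightarrow> morita_context T U P Q \<mu> \<nu> \<and>
     \<mu> \<in> bimodule_iso T T (tensor U P Q) (regular_bimodule T) \<and>
     \<nu> \<in> bimodule_iso U U (tensor T Q P) (regular_bimodule U)"

end

theory Submission
  imports Defs
begin

text \<open>For ring maps \<open>R \<rightarrow> A\<close> and \<open>S \<rightarrow> A\<close>, evaluation at \<open>1 \<otimes> 1\<close> identifies the \<open>A\<close>-\<open>A\<close>-bimodule maps
  \<open>A \<otimes>\<^sub>S A \<rightarrow> A \<otimes>\<^sub>R A\<close> with \<open>(A \<otimes>\<^sub>R A)\<^sup>S\<close>, and the product \<open>x y = y\<^sup>1 x\<^sup>1 \<otimes> x\<^sup>2 y\<^sup>2\<close> then becomes composition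
  of maps. Hence \<open>T\<close>, \<open>U\<close>, \<open>P\<close>, \<open>Q\<close> are the four hom-sets between \<open>A \<otimes>\<^sub>B A\<close> and \<open>A \<otimes>\<^sub>C A\<close>, and they form
  a Morita context.

  A Morita map whose image contains \<open>1\<close> is bijective, because \<open>\<mu>(z) w = z \<mu>(w)\<close>. If \<open>B | C\<close> is H-separable,
  then \<open>1 \<otimes> 1 = \<Sum> r\<^sub>i e\<^sub>i\<close> with \<open>r\<^sub>i\<close> in the centralizer of \<open>C\<close> and \<open>e\<^sub>i \<in> (B \<otimes>\<^sub>C B)\<^sup>B\<close>; the images of the
  \<open>e\<^sub>i\<close> in \<open>Q\<close> paired with \<open>r\<^sub>i \<otimes> 1 \<in> P\<close> give \<open>1\<^sub>U\<close>. Moreover \<open>B | C\<close> is then separable, and a separability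
  element, viewed in \<open>Q\<close> and paired with \<open>1 \<otimes> 1 \<in> P\<close>, gives \<open>1\<^sub>T\<close>.\<close>

section \<open>Auxiliary facts on additive maps and abelian groups\<close>

lemma additive_homI:
  assumes "abelian_group G" "abelian_group H"
    and "\<And>x. x \<in> carrier G \<Longrightarrow> f x \<in> carrier H"
    and "\<And>x y. x \<in> carrier G \<Longrightarrow> y \<in> carrier G \<Longrightarrow> f (x \<oplus>\<^bsub>G\<^esub> y) = f x \<oplus>\<^bsub>H\<^esub> f y"
  shows "abelian_group_hom G H f"
  by (intro abelian_group_homI abelian_group.a_group assms group_hom.intro group_hom_axioms.intro homI)
    (use assms in auto)

text \<open>A quotient group is written multiplicatively, whereas the additive group of a bimodule
  sits in the ring fields of its record. This moves the group axioms from one notation to the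
  other.\<close>

lemma abelian_group_of_comm_group:
  assumes "comm_group G"
    and "carrier H = carrier G" "ring.add H = monoid.mult G" "\<zero>\<^bsub>H\<^esub> = \<one>\<^bsub>G\<^esub>"
  shows "abelian_group H"
proof -
  interpret comm_group G by fact
  show ?thesis
    by (rule abelian_groupI) (use assms in \<open>auto simp: m_ac intro: l_inv_ex\<close>)
qed

section \<open>Tensor products of bimodules\<close>

locale tensor_pair = M: bimodule L R M + N: bimodule R S N
  for L :: "('l, 'i) ring_scheme" and R :: "('r, 'j) ring_scheme" and S :: "('s, 'k) ring_scheme"
    and M :: "('l, 'r, 'x) bimodule" and N :: "('r, 's, 'y) bimodule"
begin

abbreviation (input) F where "F \<equiv> free_pairs M N"
abbreviation (input) K where "K \<equiv> tensor_kernel R M N"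
abbreviation (input) MN where "MN \<equiv> tensor R M N"
abbreviation (input) coset where "coset c \<equiv> K #>\<^bsub>F\<^esub> c"

lemma abelian_groups: "abelian_group M" "abelian_group N"
  by (rule M.abelian_group_axioms N.abelian_group_axioms)+

lemma comm_group_free_pairs: "comm_group F"
  by (simp add: free_pairs_def abelian_free_Abelian_group)

lemma relations_closed: "tensor_relations R M N \<subseteq> carrier F"
  \<comment> \<open>\<open>balanced_kernel(1)\<close> gives closure in the presence of some balanced
    map; the zero map into \<open>M\<close> serves.\<close>
  by (rule balanced_kernel(1)[of M N M R "\<lambda>_ _. \<zero>\<^bsub>M\<^esub>"])
    (auto simp: balanced_def abelian_groups M.ract_closed N.lact_closed)

lemma subgroup_kernel: "subgroup K F"
  unfolding tensor_kernel_def
  by (rule group.generate_is_subgroup[OF comm_group.axioms(2)[OF comm_group_free_pairs] relations_closed])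

lemma kernel_normal: "normal K F"
  by (rule comm_group.normal_iff_subgroup[OF comm_group_free_pairs, THEN iffD2, OF subgroup_kernel])

lemma comm_group_quotient: "comm_group (F Mod K)"
  by (rule comm_group.abelian_FactGroup[OF comm_group_free_pairs subgroup_kernel])

lemma tensor_group_simps:
  "carrier (tensor_group R M N) = carrier (F Mod K)"
  "ring.add (tensor_group R M N) = monoid.mult (F Mod K)"
  "\<zero>\<^bsub>tensor_group R M N\<^esub> = K"
  by (simp_all add: tensor_group_def Let_def FactGroup_def)

lemma tensor_simps:
  "carrier MN = carrier (F Mod K)"
  "ring.add MN = monoid.mult (F Mod K)"
  "\<zero>\<^bsub>MN\<^esub> = K"
  by (simp_all add: tensor_def Let_def tensor_group_simps)

lemma abelian_group_tensor_group: "abelian_group (tensor_group R M N)"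
  by (rule abelian_group_of_comm_group[OF comm_group_quotient])
    (simp_all add: tensor_group_simps FactGroup_def)

lemma abelian_group_tensor: "abelian_group MN"
  by (rule abelian_group_of_comm_group[OF comm_group_quotient])
    (simp_all add: tensor_simps FactGroup_def)

sublocale T: abelian_group "tensor R M N"
  by (rule abelian_group_tensor)

lemma coset_closed: "c \<in> carrier F \<Longrightarrow> coset c \<in> carrier MN"
  by (auto simp: tensor_simps FactGroup_def RCOSETS_def)

lemma coset_add:
  "\<lbrakk>c \<in> carrier F; d \<in> carrier F\<rbrakk>
    \<Longrightarrow> coset c \<oplus>\<^bsub>MN\<^esub> coset d = coset (c + d)"
  using normal.rcos_sum[OF kernel_normal, of c d]
  by (simp add: tensor_simps FactGroup_def) (simp add: free_pairs_def)

lemma carrierE: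
  assumes "z \<in> carrier MN"
  obtains c where "c \<in> carrier F" "z = coset c"
  using assms by (auto simp: tensor_simps FactGroup_def RCOSETS_def)

lemma coset_eqI:
  assumes "c - d \<in> K" "d \<in> carrier F"
  shows "coset c = coset d"
proof -
  interpret F: group F by (rule comm_group.axioms(2)[OF comm_group_free_pairs])
  have "K #>\<^bsub>F\<^esub> ((c - d) \<otimes>\<^bsub>F\<^esub> d) = coset (c - d) #>\<^bsub>F\<^esub> d"
    using assms subgroup.subset[OF subgroup_kernel] by (intro F.coset_mult_assoc[symmetric]) auto
  also have "coset (c - d) = K"
    using assms subgroup.subset[OF subgroup_kernel] by (intro F.coset_join2 subgroup_kernel) auto
  finally show ?thesis by (simp add: free_pairs_def)
qed

lemma frag_of_closed [simp]:
  "\<lbrakk>m \<in> carrier M; n \<in> carrier N\<rbrakk> \<Longrightarrow> frag_of (m, n) \<in> carrier F"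
  by (simp add: free_pairs_def)

lemma add_closed_free_pairs: "\<lbrakk>c \<in> carrier F; d \<in> carrier F\<rbrakk> \<Longrightarrow> c + d \<in> carrier F"
  using group.is_monoid[OF comm_group.axioms(2)[OF comm_group_free_pairs], THEN monoid.m_closed, of c d]
  by (simp add: free_pairs_def)

text \<open>The three balancing laws are the three families of generators of the kernel. In the two
  additive laws the difference is regrouped as \<open>c - (a + b)\<close> so that
  \<open>coset_eqI\<close> applies.\<close>

lemma pure_tensor_balanced: "balanced R M N MN (pure_tensor R M N)"
proof -
  have rel: "z \<in> tensor_relations R M N \<Longrightarrow> z \<in> K" for z
    by (simp add: tensor_kernel_def generate.incl)
  show ?thesis
    unfolding balanced_def pure_tensor_def
  proof (intro conjI ballI)
    fix m n assume "m \<in> carrier M" "n \<in> carrier N"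
    then show "coset (frag_of (m, n)) \<in> carrier MN" by (simp add: coset_closed)
  next
    fix m m' n assume *: "m \<in> carrier M" "m' \<in> carrier M" "n \<in> carrier N"
    then have "frag_of (m \<oplus>\<^bsub>M\<^esub> m', n) - (frag_of (m, n) + frag_of (m', n)) \<in> K"
      unfolding diff_diff_eq[symmetric] by (intro rel) (unfold tensor_relations_def, blast)
    then show "coset (frag_of (m \<oplus>\<^bsub>M\<^esub> m', n))
        = coset (frag_of (m, n)) \<oplus>\<^bsub>MN\<^esub> coset (frag_of (m', n))"
      using * by (simp add: coset_add coset_eqI add_closed_free_pairs)
  next
    fix m n n' assume *: "m \<in> carrier M" "n \<in> carrier N" "n' \<in> carrier N"
    then have "frag_of (m, n \<oplus>\<^bsub>N\<^esub> n') - (frag_of (m, n) + frag_of (m, n')) \<in> K"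
      unfolding diff_diff_eq[symmetric] by (intro rel) (unfold tensor_relations_def, blast)
    then show "coset (frag_of (m, n \<oplus>\<^bsub>N\<^esub> n'))
        = coset (frag_of (m, n)) \<oplus>\<^bsub>MN\<^esub> coset (frag_of (m, n'))"
      using * by (simp add: coset_add coset_eqI add_closed_free_pairs)
  next
    fix m r n assume *: "m \<in> carrier M" "r \<in> carrier R" "n \<in> carrier N"
    then have "frag_of (ract M m r, n) - frag_of (m, lact N r n) \<in> K"
      by (intro rel) (unfold tensor_relations_def, blast)
    then show "coset (frag_of (ract M m r, n)) = coset (frag_of (m, lact N r n))"
      using * by (simp add: coset_eqI N.lact_closed)
  qed
qed

lemma pure_closed [simp]:
    "\<lbrakk>m \<in> carrier M; n \<in> carrier N\<rbrakk> \<Longrightarrow> pure_tensor R M N m n \<in> carrier MN"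
  and pure_add_left: "\<lbrakk>m \<in> carrier M; m' \<in> carrier M; n \<in> carrier N\<rbrakk>
    \<Longrightarrow> pure_tensor R M N (m \<oplus>\<^bsub>M\<^esub> m') n = pure_tensor R M N m n \<oplus>\<^bsub>MN\<^esub> pure_tensor R M N m' n"
  and pure_add_right: "\<lbrakk>m \<in> carrier M; n \<in> carrier N; n' \<in> carrier N\<rbrakk>
    \<Longrightarrow> pure_tensor R M N m (n \<oplus>\<^bsub>N\<^esub> n') = pure_tensor R M N m n \<oplus>\<^bsub>MN\<^esub> pure_tensor R M N m n'"
  and pure_balance: "\<lbrakk>m \<in> carrier M; r \<in> carrier R; n \<in> carrier N\<rbrakk>
    \<Longrightarrow> pure_tensor R M N (ract M m r) n = pure_tensor R M N m (lact N r n)"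
  using pure_tensor_balanced unfolding balanced_def by blast+

lemma pure_zero_left:
  assumes n: "n \<in> carrier N"
  shows "pure_tensor R M N \<zero>\<^bsub>M\<^esub> n = \<zero>\<^bsub>MN\<^esub>"
proof -
  have "pure_tensor R M N \<zero>\<^bsub>M\<^esub> n \<oplus>\<^bsub>MN\<^esub> pure_tensor R M N \<zero>\<^bsub>M\<^esub> n = pure_tensor R M N \<zero>\<^bsub>M\<^esub> n"
    using pure_add_left[of "\<zero>\<^bsub>M\<^esub>" "\<zero>\<^bsub>M\<^esub>" n] n by simp
  then show ?thesis using n by (simp add: T.add.r_cancel_one')
qed

lemma pure_minus_left:
  assumes "m \<in> carrier M" "n \<in> carrier N"
  shows "pure_tensor R M N (\<ominus>\<^bsub>M\<^esub> m) n = \<ominus>\<^bsub>MN\<^esub> pure_tensor R M N m n"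
  using pure_add_left[of "\<ominus>\<^bsub>M\<^esub> m" m n] assms
  by (intro T.minus_equality[symmetric]) (simp_all add: M.l_neg pure_zero_left)

text \<open>Zero and negation get no case of their own: zero is the pure tensor of two zeros, and
  \<open>- (m \<otimes> n) = (- m) \<otimes> n\<close>, so every element is a sum of pure
  tensors.\<close>

lemma tensor_induct [consumes 1, case_names pure add]:
  assumes z: "z \<in> carrier MN"
    and pure: "\<And>m n. m \<in> carrier M \<Longrightarrow> n \<in> carrier N \<Longrightarrow> Q (pure_tensor R M N m n)"
    and add: "\<And>x y. \<lbrakk>x \<in> carrier MN; y \<in> carrier MN; Q x; Q y\<rbrakk> \<Longrightarrow> Q (x \<oplus>\<^bsub>MN\<^esub> y)"
  shows "Q z"
proof -
  have Q0: "Q \<zero>\<^bsub>MN\<^esub>"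
    using pure[of "\<zero>\<^bsub>M\<^esub>" "\<zero>\<^bsub>N\<^esub>"] by (simp add: pure_zero_left)
  have FI: "c \<in> carrier F \<longleftrightarrow> Poly_Mapping.keys c \<subseteq> carrier M \<times> carrier N" for c
    by (simp add: free_pairs_def)
  have minus: "coset (- c) = \<ominus>\<^bsub>MN\<^esub> coset c" if "c \<in> carrier F" for c
  proof (rule T.minus_equality[symmetric])
    have "- c \<in> carrier F" using that by (simp add: FI)
    then show "coset (- c) \<oplus>\<^bsub>MN\<^esub> coset c = \<zero>\<^bsub>MN\<^esub>"
      using that coset_eqI[of "0" "0"] group.coset_mult_one[OF comm_group.axioms(2)[OF comm_group_free_pairs], of K]
        subgroup.subset[OF subgroup_kernel]
      by (simp add: coset_add tensor_simps(3)) (simp add: free_pairs_def)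
    show "coset c \<in> carrier MN" "coset (- c) \<in> carrier MN"
      using that \<open>- c \<in> carrier F\<close> by (simp_all add: coset_closed)
  qed
  have zero: "coset 0 = \<zero>\<^bsub>MN\<^esub>"
    using group.coset_mult_one[OF comm_group.axioms(2)[OF comm_group_free_pairs], of K]
      subgroup.subset[OF subgroup_kernel] by (simp add: tensor_simps(3)) (simp add: free_pairs_def)
  \<comment> \<open>Induction on the free abelian group passes through differences
    \<open>x - y\<close>, so the claim is carried for a coset and its negative together.\<close>
  have "Q (coset c) \<and> Q (\<ominus>\<^bsub>MN\<^esub> coset c)" if "Poly_Mapping.keys c \<subseteq> carrier M \<times> carrier N" for c
    using that
  proof (induction c rule: free_Abelian_group_induct[consumes 1, case_names 1 2 3])
    case 1
    have "\<ominus>\<^bsub>MN\<^esub> \<zero>\<^bsub>MN\<^esub> = \<zero>\<^bsub>MN\<^esub>" by (rule T.minus_equality) simp_all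
    then show ?case unfolding zero using Q0 by metis
  next
    case (2 x y)
    then have *: "x \<in> carrier F" "y \<in> carrier F" "- y \<in> carrier F" by (simp_all add: FI)
    note cl = coset_closed[OF *(1)] coset_closed[OF *(2)]
    have e: "coset (x - y) = coset x \<oplus>\<^bsub>MN\<^esub> \<ominus>\<^bsub>MN\<^esub> coset y"
      using coset_add[OF *(1,3)] minus[OF *(2)] by simp
    then have e': "\<ominus>\<^bsub>MN\<^esub> (coset (x - y)) = \<ominus>\<^bsub>MN\<^esub> coset x \<oplus>\<^bsub>MN\<^esub> coset y"
      using cl by (simp add: T.minus_add)
    show ?case unfolding e' unfolding e using 2 cl by (auto intro!: add)
  next
    case (3 a)
    then obtain m n where a: "a = (m, n)" "m \<in> carrier M" "n \<in> carrier N" by auto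
    show ?case
      using pure[OF a(2,3)] pure[of "\<ominus>\<^bsub>M\<^esub> m" n] a pure_minus_left[OF a(2,3)]
      by (simp add: pure_tensor_def)
  qed
  then show ?thesis using z by (auto simp: FI elim!: carrierE)
qed

text \<open>On the coset of \<open>c\<close> the lift takes the value
  \<open>free_extension G h c\<close>, so additivity is inherited from the free abelian
  group.\<close>

lemma tensor_lift_hom:
  assumes G: "abelian_group G" and h: "balanced R M N G h"
  shows "abelian_group_hom MN G (tensor_lift G h)"
proof -
  have hc: "\<And>m n. m \<in> carrier M \<Longrightarrow> n \<in> carrier N \<Longrightarrow> h m n \<in> carrier G"
    using h by (simp add: balanced_def)
  note lift = tensor_lift_coset[OF abelian_groups G h M.ract_closed N.lact_closed]
  have hom: "free_extension G h \<in> hom F (add_monoid G)"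
    unfolding free_pairs_def by (rule free_extension_hom[OF G hc])
  show ?thesis
  proof (rule additive_homI[OF abelian_group_tensor G])
    fix x assume "x \<in> carrier MN"
    then obtain c where c: "c \<in> carrier F" "x = coset c" by (rule carrierE)
    then show "tensor_lift G h x \<in> carrier G"
      using hom by (auto simp: lift hom_def)
    fix y assume "y \<in> carrier MN"
    then obtain d where d: "d \<in> carrier F" "y = coset d" by (rule carrierE)
    have "free_extension G h (c \<otimes>\<^bsub>F\<^esub> d) = free_extension G h c \<oplus>\<^bsub>G\<^esub> free_extension G h d"
      using hom c d by (simp add: hom_def)
    then have "free_extension G h (c + d) = free_extension G h c \<oplus>\<^bsub>G\<^esub> free_extension G h d"
      by (simp add: free_pairs_def)
    then show "tensor_lift G h (x \<oplus>\<^bsub>MN\<^esub> y) = tensor_lift G h x \<oplus>\<^bsub>G\<^esub> tensor_lift G h y"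
      using c d by (simp add: lift coset_add add_closed_free_pairs)
  qed
qed

lemma lift_pure:
  assumes "abelian_group G" "balanced R M N G h" "m \<in> carrier M" "n \<in> carrier N"
  shows "tensor_lift G h (pure_tensor R M N m n) = h m n"
  by (rule tensor_lift_pure[OF abelian_groups assms(1,2) M.ract_closed N.lact_closed assms(3,4)])

lemma hom_eqI:
  assumes f: "abelian_group_hom MN G f" and g: "abelian_group_hom MN G g"
    and eq: "\<And>m n. m \<in> carrier M \<Longrightarrow> n \<in> carrier N
      \<Longrightarrow> f (pure_tensor R M N m n) = g (pure_tensor R M N m n)"
    and z: "z \<in> carrier MN"
  shows "f z = g z"
  using z
proof (induction z rule: tensor_induct)
  case (add x y)
  then show ?case
    by (simp add: abelian_group_hom.hom_add[OF f] abelian_group_hom.hom_add[OF g])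
qed (rule eq)

section \<open>The outer actions on a tensor product\<close>

lemma lact_balanced:
  assumes "l \<in> carrier L"
  shows "balanced R M N MN (\<lambda>m n. pure_tensor R M N (lact M l m) n)"
  using assms unfolding balanced_def
  by (auto simp: M.lact_closed M.lact_add_right pure_add_left pure_add_right N.lact_closed
      M.lact_ract[symmetric] pure_balance)

lemma ract_balanced:
  assumes "s \<in> carrier S"
  shows "balanced R M N MN (\<lambda>m n. pure_tensor R M N m (ract N n s))"
  using assms unfolding balanced_def
  by (auto simp: N.ract_closed N.ract_add_left pure_add_left pure_add_right M.ract_closed
      N.lact_ract pure_balance)

text \<open>The actions of \<open>tensor\<close> are defined as lifts into
  \<open>tensor_group\<close>, a record of another type with the same carrier and addition. This
  lemma and the next one bridge the two records.\<close>

lemma balanced_tensor_group: "balanced R M N MN h \<Longrightarrow> balanced R M N (tensor_group R M N) h"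
  by (simp add: balanced_def tensor_simps tensor_group_simps)

lemma tensor_group_hom: "abelian_group_hom MN (tensor_group R M N) f \<Longrightarrow> abelian_group_hom MN MN f"
  by (intro additive_homI abelian_group_tensor)
    (auto dest: abelian_group_hom.hom_closed abelian_group_hom.hom_add simp: tensor_simps tensor_group_simps)

lemma lact_tensor: "lact MN l = tensor_lift (tensor_group R M N) (\<lambda>m n. pure_tensor R M N (lact M l m) n)"
  and ract_tensor: "ract MN z s = tensor_lift (tensor_group R M N) (\<lambda>m n. pure_tensor R M N m (ract N n s)) z"
  by (simp_all add: tensor_def Let_def)

lemma lact_hom: "l \<in> carrier L \<Longrightarrow> abelian_group_hom MN MN (lact MN l)"
  unfolding lact_tensor
  by (intro tensor_group_hom tensor_lift_hom abelian_group_tensor_group balanced_tensor_group lact_balanced)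

lemma ract_hom: "s \<in> carrier S \<Longrightarrow> abelian_group_hom MN MN (\<lambda>z. ract MN z s)"
  unfolding ract_tensor
  by (intro tensor_group_hom tensor_lift_hom abelian_group_tensor_group balanced_tensor_group ract_balanced)

lemma lact_pure: "\<lbrakk>l \<in> carrier L; m \<in> carrier M; n \<in> carrier N\<rbrakk>
    \<Longrightarrow> lact MN l (pure_tensor R M N m n) = pure_tensor R M N (lact M l m) n"
  unfolding lact_tensor
  by (intro lift_pure abelian_group_tensor_group balanced_tensor_group lact_balanced)

lemma ract_pure: "\<lbrakk>m \<in> carrier M; n \<in> carrier N; s \<in> carrier S\<rbrakk>
    \<Longrightarrow> ract MN (pure_tensor R M N m n) s = pure_tensor R M N m (ract N n s)"
  unfolding ract_tensor
  by (intro lift_pure abelian_group_tensor_group balanced_tensor_group ract_balanced)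

text \<open>Both actions are additive in the tensor. The remaining identities are checked on pure
  tensors, where the left action touches only the first factor and the right action only the
  second.\<close>

lemma bimodule_tensor: "bimodule L S MN"
proof (intro bimodule.intro bimodule_axioms.intro M.ring_axioms N.S.ring_axioms abelian_group_tensor)
  note l_add = abelian_group_hom.hom_add[OF lact_hom] and r_add = abelian_group_hom.hom_add[OF ract_hom]
  have l_cl: "lact MN l z \<in> carrier MN" if "l \<in> carrier L" "z \<in> carrier MN" for l z
    using abelian_group_hom.hom_closed[OF lact_hom] that by simp
  have r_cl: "ract MN z s \<in> carrier MN" if "z \<in> carrier MN" "s \<in> carrier S" for z s
    using abelian_group_hom.hom_closed[OF ract_hom] that by simp
  note cl = l_cl r_cl M.lact_closed N.ract_closed
  {
    fix l x y assume "l \<in> carrier L" "x \<in> carrier MN" "y \<in> carrier MN"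
    then show "lact MN l (x \<oplus>\<^bsub>MN\<^esub> y) = lact MN l x \<oplus>\<^bsub>MN\<^esub> lact MN l y" by (rule l_add)
  next
    fix s x y assume "x \<in> carrier MN" "y \<in> carrier MN" "s \<in> carrier S"
    then show "ract MN (x \<oplus>\<^bsub>MN\<^esub> y) s = ract MN x s \<oplus>\<^bsub>MN\<^esub> ract MN y s" by (intro r_add)
  next
    fix l l' x assume l: "l \<in> carrier L" "l' \<in> carrier L" and x: "x \<in> carrier MN"
    from x show "lact MN (l \<oplus>\<^bsub>L\<^esub> l') x = lact MN l x \<oplus>\<^bsub>MN\<^esub> lact MN l' x"
      by (induction x rule: tensor_induct)
        (use l in \<open>simp_all add: lact_pure cl M.lact_add_left pure_add_left l_add M.a_closed T.a_ac\<close>)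
    from x show "lact MN (l \<otimes>\<^bsub>L\<^esub> l') x = lact MN l (lact MN l' x)"
      by (induction x rule: tensor_induct)
        (use l in \<open>simp_all add: lact_pure cl M.lact_mult l_add\<close>)
  next
    fix s s' x assume s: "s \<in> carrier S" "s' \<in> carrier S" and x: "x \<in> carrier MN"
    from x show "ract MN x (s \<oplus>\<^bsub>S\<^esub> s') = ract MN x s \<oplus>\<^bsub>MN\<^esub> ract MN x s'"
      by (induction x rule: tensor_induct)
        (use s in \<open>simp_all add: ract_pure cl N.ract_add_right pure_add_right r_add T.a_ac\<close>)
    from x show "ract MN x (s \<otimes>\<^bsub>S\<^esub> s') = ract MN (ract MN x s) s'"
      by (induction x rule: tensor_induct)
        (use s in \<open>simp_all add: ract_pure cl N.ract_mult r_add\<close>)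
  next
    fix x assume x: "x \<in> carrier MN"
    from x show "lact MN \<one>\<^bsub>L\<^esub> x = x"
      by (induction x rule: tensor_induct) (simp_all add: lact_pure M.lact_one l_add)
    from x show "ract MN x \<one>\<^bsub>S\<^esub> = x"
      by (induction x rule: tensor_induct) (simp_all add: ract_pure N.ract_one r_add)
  next
    fix l x s assume l: "l \<in> carrier L" and s: "s \<in> carrier S" and x: "x \<in> carrier MN"
    from x show "ract MN (lact MN l x) s = lact MN l (ract MN x s)"
      by (induction x rule: tensor_induct)
        (use l s in \<open>simp_all add: lact_pure ract_pure cl l_add r_add\<close>)
  }
qed (auto intro: M.R.ring_axioms abelian_group_hom.hom_closed[OF lact_hom] abelian_group_hom.hom_closed[OF ract_hom])

end

section \<open>Transfer of abelian groups to subsets and to other records\<close>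

lemma abelian_group_of_subset:
  assumes "abelian_group G"
    and "D \<subseteq> carrier G" "\<zero>\<^bsub>G\<^esub> \<in> D" "\<And>x y. x \<in> D \<Longrightarrow> y \<in> D \<Longrightarrow> x \<oplus>\<^bsub>G\<^esub> y \<in> D"
    and "\<And>x. x \<in> D \<Longrightarrow> \<ominus>\<^bsub>G\<^esub> x \<in> D"
    and "carrier H = D" "ring.add H = ring.add G" "\<zero>\<^bsub>H\<^esub> = \<zero>\<^bsub>G\<^esub>"
  shows "abelian_group H"
proof -
  interpret abelian_group G by fact
  have D: "x \<in> carrier G" if "x \<in> D" for x using that assms by auto
  show ?thesis
  proof (rule abelian_groupI)
    show "\<exists>y \<in> carrier H. y \<oplus>\<^bsub>H\<^esub> x = \<zero>\<^bsub>H\<^esub>" if "x \<in> carrier H" for x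
      using that assms(5-) D l_neg by (intro bexI[of _ "\<ominus>\<^bsub>G\<^esub> x"]) auto
  qed (use assms(3-) in \<open>auto simp: a_ac D\<close>)
qed

lemma abelian_group_cong:
  assumes "abelian_group G" "carrier H = carrier G" "ring.add H = ring.add G" "\<zero>\<^bsub>H\<^esub> = \<zero>\<^bsub>G\<^esub>"
  shows "abelian_group H"
  by (rule abelian_group_of_comm_group[OF abelian_group.a_comm_group[OF assms(1)]]) (use assms in auto)

section \<open>Bimodule maps\<close>

lemma bimodule_homD:
  assumes "\<phi> \<in> bimodule_hom R S M N"
  shows "x \<in> carrier M \<Longrightarrow> \<phi> x \<in> carrier N"
    and "x \<in> carrier M \<Longrightarrow> y \<in> carrier M \<Longrightarrow> \<phi> (x \<oplus>\<^bsub>M\<^esub> y) = \<phi> x \<oplus>\<^bsub>N\<^esub> \<phi> y"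
    and "r \<in> carrier R \<Longrightarrow> x \<in> carrier M \<Longrightarrow> \<phi> (lact M r x) = lact N r (\<phi> x)"
    and "x \<in> carrier M \<Longrightarrow> s \<in> carrier S \<Longrightarrow> \<phi> (ract M x s) = ract N (\<phi> x) s"
  using assms by (auto simp: bimodule_hom_def)

lemma bimodule_hom_abelian:
  assumes "\<phi> \<in> bimodule_hom R S M N" "abelian_group M" "abelian_group N"
  shows "abelian_group_hom M N \<phi>"
  by (rule additive_homI[OF assms(2,3) bimodule_homD(1,2)[OF assms(1)]])

lemma bimodule_hom_comp:
  assumes "\<phi> \<in> bimodule_hom R S M N" "\<psi> \<in> bimodule_hom R S N M'"
  shows "(\<lambda>x. \<psi> (\<phi> x)) \<in> bimodule_hom R S M M'"
  using assms by (auto simp: bimodule_hom_def Pi_iff)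

lemma (in ring) bimodule_regular: "bimodule R R (regular_bimodule R)"
proof -
  have "abelian_group (regular_bimodule R)"
    by (rule abelian_group_cong[OF abelian_group_axioms]) (simp_all add: regular_bimodule_def)
  then show ?thesis
    by (intro bimodule.intro bimodule_axioms.intro ring_axioms)
      (simp_all add: regular_bimodule_def l_distr r_distr m_assoc)
qed

lemma bimodule_restrict_scalars:
  assumes "bimodule R S M" "ring P" "ring Q" "\<rho> \<in> ring_hom P R" "\<sigma> \<in> ring_hom Q S"
  shows "bimodule P Q (restrict_scalars \<rho> \<sigma> M)"
proof -
  interpret bimodule R S M by fact
  have "abelian_group (restrict_scalars \<rho> \<sigma> M)"
    by (rule abelian_group_cong[OF M.abelian_group_axioms]) (simp_all add: restrict_scalars_def)
  moreover note ring_hom_closed[OF assms(4)] ring_hom_closed[OF assms(5)]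
  ultimately show ?thesis
    by (intro bimodule.intro bimodule_axioms.intro assms)
      (simp_all add: restrict_scalars_def ring_hom_add[OF assms(4)] ring_hom_add[OF assms(5)]
        ring_hom_mult[OF assms(4)] ring_hom_mult[OF assms(5)] ring_hom_one[OF assms(4)]
        ring_hom_one[OF assms(5)] lact_closed ract_closed lact_add_left lact_add_right ract_add_left
        ract_add_right lact_mult ract_mult lact_one ract_one lact_ract)
qed

lemma (in bimodule) act_homs:
  shows "r \<in> carrier R \<Longrightarrow> abelian_group_hom M M (lact M r)"
    and "s \<in> carrier S \<Longrightarrow> abelian_group_hom M M (\<lambda>x. ract M x s)"
  by (intro additive_homI M.abelian_group_axioms; simp add: lact_closed ract_closed lact_add_right ract_add_left)+

lemma (in bimodule) act_zero_minus:
  shows "r \<in> carrier R \<Longrightarrow> lact M r \<zero>\<^bsub>M\<^esub> = \<zero>\<^bsub>M\<^esub>"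
    and "s \<in> carrier S \<Longrightarrow> ract M \<zero>\<^bsub>M\<^esub> s = \<zero>\<^bsub>M\<^esub>"
    and "\<lbrakk>r \<in> carrier R; x \<in> carrier M\<rbrakk> \<Longrightarrow> lact M r (\<ominus>\<^bsub>M\<^esub> x) = \<ominus>\<^bsub>M\<^esub> lact M r x"
    and "\<lbrakk>s \<in> carrier S; x \<in> carrier M\<rbrakk> \<Longrightarrow> ract M (\<ominus>\<^bsub>M\<^esub> x) s = \<ominus>\<^bsub>M\<^esub> ract M x s"
  using abelian_group_hom.hom_zero[OF act_homs(1)] abelian_group_hom.hom_zero[OF act_homs(2)]
    abelian_group_hom.hom_a_inv[OF act_homs(1)] abelian_group_hom.hom_a_inv[OF act_homs(2)] by blast+

text \<open>For \<open>m \<in> M\<^sup>R\<close> this is the bimodule map \<open>A \<otimes>\<^sub>R A \<rightarrow> M\<close> with \<open>1 \<otimes> 1 \<mapsto> m\<close>.\<close>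

definition ext_map where
  "ext_map M m = tensor_lift M (\<lambda>x y. lact M x (ract M m y))"

section \<open>The bimodule \<open>A \<otimes>\<^sub>R A\<close> and its universal property\<close>

locale ring_extension = ring_hom_ring R A \<rho>
  for A :: "('a, 'i) ring_scheme" and R :: "('r, 'j) ring_scheme" and \<rho>
begin

abbreviation (input) AR where "AR \<equiv> restrict_scalars id \<rho> (regular_bimodule A)"
abbreviation (input) RA where "RA \<equiv> restrict_scalars \<rho> id (regular_bimodule A)"
abbreviation (input) E where "E \<equiv> ext_tensor A R \<rho>"
abbreviation (input) pt where "pt \<equiv> ext_pure A R \<rho>"

sublocale E: tensor_pair A R A AR RA
proof -
  have id: "id \<in> ring_hom A A" by (rule ring_hom_memI) auto
  show "tensor_pair A R A AR RA"
    by (intro tensor_pair.intro bimodule_restrict_scalars[OF S.bimodule_regular] R.ring_axioms S.ring_axioms id homh)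
qed

lemma base_simps [simp]:
  "carrier AR = carrier A" "carrier RA = carrier A" "ring.add AR = ring.add A" "ring.add RA = ring.add A"
  "lact AR = monoid.mult A" "ract RA = monoid.mult A"
  "ract AR x r = x \<otimes>\<^bsub>A\<^esub> \<rho> r" "lact RA r x = \<rho> r \<otimes>\<^bsub>A\<^esub> x"
  by (auto simp: restrict_scalars_def regular_bimodule_def)

lemma bimodule_E: "bimodule A A E"
  unfolding ext_tensor_def by (rule E.bimodule_tensor)

sublocale B: bimodule A A "ext_tensor A R \<rho>"
  by (rule bimodule_E)

lemma pt_closed [simp]: "\<lbrakk>x \<in> carrier A; y \<in> carrier A\<rbrakk> \<Longrightarrow> pt x y \<in> carrier E"
  and pt_add_left: "\<lbrakk>x \<in> carrier A; x' \<in> carrier A; y \<in> carrier A\<rbrakk>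
    \<Longrightarrow> pt (x \<oplus>\<^bsub>A\<^esub> x') y = pt x y \<oplus>\<^bsub>E\<^esub> pt x' y"
  and pt_add_right: "\<lbrakk>x \<in> carrier A; y \<in> carrier A; y' \<in> carrier A\<rbrakk>
    \<Longrightarrow> pt x (y \<oplus>\<^bsub>A\<^esub> y') = pt x y \<oplus>\<^bsub>E\<^esub> pt x y'"
  and pt_balance: "\<lbrakk>x \<in> carrier A; r \<in> carrier R; y \<in> carrier A\<rbrakk>
    \<Longrightarrow> pt (x \<otimes>\<^bsub>A\<^esub> \<rho> r) y = pt x (\<rho> r \<otimes>\<^bsub>A\<^esub> y)"
  and lact_pt: "\<lbrakk>a \<in> carrier A; x \<in> carrier A; y \<in> carrier A\<rbrakk> \<Longrightarrow> lact E a (pt x y) = pt (a \<otimes>\<^bsub>A\<^esub> x) y"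
  and ract_pt: "\<lbrakk>a \<in> carrier A; x \<in> carrier A; y \<in> carrier A\<rbrakk> \<Longrightarrow> ract E (pt x y) a = pt x (y \<otimes>\<^bsub>A\<^esub> a)"
  using E.pure_closed[of x y] E.pure_add_left[of x x' y] E.pure_add_right[of x y y']
    E.pure_balance[of x r y] E.lact_pure[of a x y] E.ract_pure[of x y a]
  by (simp_all add: ext_tensor_def ext_pure_def)

lemma ext_induct [consumes 1, case_names pure add]:
  assumes "z \<in> carrier E"
    and "\<And>x y. x \<in> carrier A \<Longrightarrow> y \<in> carrier A \<Longrightarrow> Q (pt x y)"
    and "\<And>x y. \<lbrakk>x \<in> carrier E; y \<in> carrier E; Q x; Q y\<rbrakk> \<Longrightarrow> Q (x \<oplus>\<^bsub>E\<^esub> y)"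
  shows "Q z"
  using assms E.tensor_induct[of z Q] by (simp add: ext_tensor_def ext_pure_def)

lemma ext_lift:
  assumes "abelian_group G"
    and "\<And>x y. x \<in> carrier A \<Longrightarrow> y \<in> carrier A \<Longrightarrow> h x y \<in> carrier G"
    and "\<And>x x' y. \<lbrakk>x \<in> carrier A; x' \<in> carrier A; y \<in> carrier A\<rbrakk> \<Longrightarrow> h (x \<oplus>\<^bsub>A\<^esub> x') y = h x y \<oplus>\<^bsub>G\<^esub> h x' y"
    and "\<And>x y y'. \<lbrakk>x \<in> carrier A; y \<in> carrier A; y' \<in> carrier A\<rbrakk> \<Longrightarrow> h x (y \<oplus>\<^bsub>A\<^esub> y') = h x y \<oplus>\<^bsub>G\<^esub> h x y'"
    and "\<And>x r y. \<lbrakk>x \<in> carrier A; r \<in> carrier R; y \<in> carrier A\<rbrakk> \<Longrightarrow> h (x \<otimes>\<^bsub>A\<^esub> \<rho> r) y = h x (\<rho> r \<otimes>\<^bsub>A\<^esub> y)"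
  shows "abelian_group_hom E G (tensor_lift G h)"
    and "\<lbrakk>x \<in> carrier A; y \<in> carrier A\<rbrakk> \<Longrightarrow> tensor_lift G h (pt x y) = h x y"
proof -
  have b: "balanced R AR RA G h" using assms(2-) by (auto simp: balanced_def)
  show "abelian_group_hom E G (tensor_lift G h)"
    unfolding ext_tensor_def by (rule E.tensor_lift_hom[OF assms(1) b])
  show "\<lbrakk>x \<in> carrier A; y \<in> carrier A\<rbrakk> \<Longrightarrow> tensor_lift G h (pt x y) = h x y"
    unfolding ext_pure_def using E.lift_pure[OF assms(1) b] by simp
qed

lemma ext_hom_eqI:
  assumes "abelian_group_hom E G f" "abelian_group_hom E G g"
    and "\<And>x y. x \<in> carrier A \<Longrightarrow> y \<in> carrier A \<Longrightarrow> f (pt x y) = g (pt x y)" and "z \<in> carrier E"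
  shows "f z = g z"
  using assms E.hom_eqI[of G f g z] by (simp add: ext_tensor_def ext_pure_def)

lemma pt_eq: "\<lbrakk>x \<in> carrier A; y \<in> carrier A\<rbrakk> \<Longrightarrow> pt x y = lact E x (ract E (pt \<one>\<^bsub>A\<^esub> \<one>\<^bsub>A\<^esub>) y)"
  by (simp add: ract_pt lact_pt)

text \<open>Since \<open>x \<otimes> y = x (1 \<otimes> 1) y\<close>, a bimodule map is determined
  by its value at \<open>1 \<otimes> 1\<close>. Identities for \<open>nested_mult\<close> are later
  proved by comparing this one value.\<close>

lemma bimodule_hom_eqI:
  assumes M: "bimodule A A M" and f: "f \<in> bimodule_hom A A E M" and g: "g \<in> bimodule_hom A A E M"
    and one: "f (pt \<one>\<^bsub>A\<^esub> \<one>\<^bsub>A\<^esub>) = g (pt \<one>\<^bsub>A\<^esub> \<one>\<^bsub>A\<^esub>)" and z: "z \<in> carrier E"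
  shows "f z = g z"
proof (rule ext_hom_eqI[OF _ _ _ z])
  show "abelian_group_hom E M f" "abelian_group_hom E M g"
    using M f g by (auto intro!: bimodule_hom_abelian B.abelian_group_axioms bimodule.axioms(3))
  show "f (pt x y) = g (pt x y)" if "x \<in> carrier A" "y \<in> carrier A" for x y
    using that one
    by (subst (1 2) pt_eq) (simp_all add: bimodule_homD(3,4)[OF f] bimodule_homD(3,4)[OF g] B.ract_closed)
qed

text \<open>The assignment \<open>x \<otimes> y \<mapsto> x m y\<close> is balanced over
  \<open>R\<close> because \<open>m\<close> commutes with the image of \<open>R\<close>. Linearity
  over \<open>A\<close> is then checked on pure tensors.\<close>

lemma ext_map:
  assumes M: "bimodule A A M" and m: "m \<in> carrier M"
    and c: "\<And>r. r \<in> carrier R \<Longrightarrow> lact M (\<rho> r) m = ract M m (\<rho> r)"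
  shows ext_map_hom: "ext_map M m \<in> bimodule_hom A A E M"
    and ext_map_pt: "\<lbrakk>x \<in> carrier A; y \<in> carrier A\<rbrakk> \<Longrightarrow> ext_map M m (pt x y) = lact M x (ract M m y)"
    and ext_map_one: "ext_map M m (pt \<one>\<^bsub>A\<^esub> \<one>\<^bsub>A\<^esub>) = m"
proof -
  interpret M: bimodule A A M by (rule M)
  note simps = M.lact_closed M.ract_closed m M.lact_add_left M.lact_add_right M.ract_add_right M.ract_add_left
  have bal: "lact M (x \<otimes>\<^bsub>A\<^esub> \<rho> r) (ract M m y) = lact M x (ract M m (\<rho> r \<otimes>\<^bsub>A\<^esub> y))"
    if "x \<in> carrier A" "r \<in> carrier R" "y \<in> carrier A" for x r y
    using that by (simp add: simps M.lact_mult M.ract_mult c[symmetric] M.lact_ract)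
  have hom: "abelian_group_hom E M (ext_map M m)"
    and pt: "\<And>x y. \<lbrakk>x \<in> carrier A; y \<in> carrier A\<rbrakk> \<Longrightarrow> ext_map M m (pt x y) = lact M x (ract M m y)"
    unfolding ext_map_def
    by (rule ext_lift; simp add: simps bal M.abelian_group_axioms)+
  show "\<lbrakk>x \<in> carrier A; y \<in> carrier A\<rbrakk> \<Longrightarrow> ext_map M m (pt x y) = lact M x (ract M m y)" by (rule pt)
  show "ext_map M m (pt \<one>\<^bsub>A\<^esub> \<one>\<^bsub>A\<^esub>) = m" by (simp add: pt simps M.lact_one M.ract_one)
  note add = abelian_group_hom.hom_add[OF hom] and cl = abelian_group_hom.hom_closed[OF hom]
  have "ext_map M m (lact E a z) = lact M a (ext_map M m z)" if "z \<in> carrier E" "a \<in> carrier A" for a z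
    using that
    by (induction z rule: ext_induct)
      (simp_all add: lact_pt pt M.lact_mult simps B.lact_closed B.lact_add_right add cl)
  moreover have "ext_map M m (ract E z a) = ract M (ext_map M m z) a" if "z \<in> carrier E" "a \<in> carrier A" for a z
    using that
    by (induction z rule: ext_induct)
      (simp_all add: ract_pt pt M.ract_mult simps B.ract_closed B.ract_add_left add cl M.lact_ract)
  ultimately show "ext_map M m \<in> bimodule_hom A A E M"
    using cl add by (auto simp: bimodule_hom_def)
qed

end

section \<open>Centralizers as bimodule maps\<close>

lemma ext_centralizer_iff:
  "z \<in> ext_centralizer A R \<rho> S \<phi> \<longleftrightarrow> z \<in> carrier (ext_tensor A R \<rho>) \<and>
    (\<forall>s \<in> carrier S. lact (ext_tensor A R \<rho>) (\<phi> s) z = ract (ext_tensor A R \<rho>) z (\<phi> s))"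
  by (simp add: ext_centralizer_def centralizer_def restrict_scalars_def)

lemma ext_centralizer_closed: "z \<in> ext_centralizer A R \<rho> S \<phi> \<Longrightarrow> z \<in> carrier (ext_tensor A R \<rho>)"
  by (simp add: ext_centralizer_iff)

context ring_extension
begin

text \<open>For fixed outer factors the inner lift of \<open>nested_mult\<close> is the two-sided
  action \<open>a x b\<close>: both sides are additive in \<open>x\<close> and agree on pure
  tensors.\<close>

lemma inner_lift:
  assumes a: "a \<in> carrier A" "b \<in> carrier A" and x: "x \<in> carrier E"
  shows "tensor_lift E (\<lambda>x1 x2. pt (a \<otimes>\<^bsub>A\<^esub> x1) (x2 \<otimes>\<^bsub>A\<^esub> b)) x = lact E a (ract E x b)"
proof -
  let ?h = "\<lambda>x1 x2. pt (a \<otimes>\<^bsub>A\<^esub> x1) (x2 \<otimes>\<^bsub>A\<^esub> b)"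
  have bal: "pt (a \<otimes>\<^bsub>A\<^esub> (x \<otimes>\<^bsub>A\<^esub> \<rho> r)) (y \<otimes>\<^bsub>A\<^esub> b) = pt (a \<otimes>\<^bsub>A\<^esub> x) (\<rho> r \<otimes>\<^bsub>A\<^esub> y \<otimes>\<^bsub>A\<^esub> b)"
    if "x \<in> carrier A" "r \<in> carrier R" "y \<in> carrier A" for x r y
    using that a pt_balance[of "a \<otimes>\<^bsub>A\<^esub> x" r "y \<otimes>\<^bsub>A\<^esub> b"] by (simp add: S.m_assoc)
  note lift = ext_lift[of E ?h, OF B.abelian_group_axioms _ _ _ bal]
  have hom: "abelian_group_hom E E (tensor_lift E ?h)"
    by (rule lift(1)) (use a in \<open>simp_all add: S.l_distr S.r_distr pt_add_left pt_add_right\<close>)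
  have pure: "tensor_lift E ?h (pt x y) = pt (a \<otimes>\<^bsub>A\<^esub> x) (y \<otimes>\<^bsub>A\<^esub> b)"
    if "x \<in> carrier A" "y \<in> carrier A" for x y
    by (rule lift(2)) (use a that in \<open>simp_all add: S.l_distr S.r_distr pt_add_left pt_add_right\<close>)
  have hom': "abelian_group_hom E E (\<lambda>x. lact E a (ract E x b))"
    by (rule additive_homI)
      (use a in \<open>simp_all add: B.abelian_group_axioms B.lact_closed B.ract_closed B.ract_add_left B.lact_add_right\<close>)
  show ?thesis
    by (rule ext_hom_eqI[OF hom hom' _ x]) (use a in \<open>simp add: pure ract_pt lact_pt\<close>)
qed

lemma one_central: "pt \<one>\<^bsub>A\<^esub> \<one>\<^bsub>A\<^esub> \<in> ext_centralizer A R \<rho> R \<rho>"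
  using pt_balance[of "\<one>\<^bsub>A\<^esub>" _ "\<one>\<^bsub>A\<^esub>"] by (simp add: ext_centralizer_iff lact_pt ract_pt)

lemma id_hom: "(\<lambda>x. x) \<in> bimodule_hom A A E E"
  by (simp add: bimodule_hom_def)

context
  fixes S :: "('s, 'k) ring_scheme" and \<phi>
  assumes S: "ring_extension A S \<phi>"
begin

interpretation S: ring_extension A S \<phi> by (rule S)

text \<open>By \<open>inner_lift\<close> the outer lift sends \<open>y \<otimes> y'\<close> to
  \<open>y x y'\<close>, which is balanced over \<open>S\<close> because \<open>x\<close>
  centralizes \<open>S\<close>. So the product with \<open>x\<close> is the bimodule map sending
  \<open>1 \<otimes> 1\<close> to \<open>x\<close>.\<close>

lemma nested_mult_eq_ext_map:
  assumes x: "x \<in> ext_centralizer A R \<rho> S \<phi>" and z: "z \<in> carrier (ext_tensor A S \<phi>)"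
  shows "nested_mult A R \<rho> x z = ext_map E x z"
proof -
  note xE = ext_centralizer_closed[OF x]
  have c: "lact E (\<phi> s) x = ract E x (\<phi> s)" if "s \<in> carrier S" for s
    using x that by (simp add: ext_centralizer_iff)
  let ?h = "\<lambda>y1 y2. tensor_lift E (\<lambda>x1 x2. pt (y1 \<otimes>\<^bsub>A\<^esub> x1) (x2 \<otimes>\<^bsub>A\<^esub> y2)) x"
  note simps = inner_lift xE B.lact_closed B.ract_closed B.lact_add_left B.ract_add_right B.lact_add_right
  have bal: "?h (y \<otimes>\<^bsub>A\<^esub> \<phi> s) y' = ?h y (\<phi> s \<otimes>\<^bsub>A\<^esub> y')"
    if "y \<in> carrier A" "s \<in> carrier S" "y' \<in> carrier A" for y s y'
    using that by (simp add: simps B.lact_mult B.ract_mult c[symmetric] B.lact_ract)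
  note lift = S.ext_lift[of E ?h, OF B.abelian_group_axioms _ _ _ bal]
  have hom: "abelian_group_hom (ext_tensor A S \<phi>) E (nested_mult A R \<rho> x)"
    unfolding nested_mult_def by (rule lift(1)) (simp_all add: simps)
  have pure: "nested_mult A R \<rho> x (ext_pure A S \<phi> y y') = lact E y (ract E x y')"
    if "y \<in> carrier A" "y' \<in> carrier A" for y y'
    unfolding nested_mult_def using that by (subst lift(2)) (simp_all add: simps)
  have hom': "abelian_group_hom (ext_tensor A S \<phi>) E (ext_map E x)"
    by (rule bimodule_hom_abelian[OF S.ext_map_hom])
      (simp_all add: bimodule_E xE c B.abelian_group_axioms S.B.abelian_group_axioms)
  show ?thesis
    by (rule S.ext_hom_eqI[OF hom hom' _ z]) (simp add: pure S.ext_map_pt bimodule_E xE c)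
qed

lemma nested_mult_hom:
  assumes x: "x \<in> ext_centralizer A R \<rho> S \<phi>"
  shows "nested_mult A R \<rho> x \<in> bimodule_hom A A (ext_tensor A S \<phi>) E"
proof -
  have "ext_map E x \<in> bimodule_hom A A (ext_tensor A S \<phi>) E"
    by (rule S.ext_map_hom) (use x in \<open>simp_all add: bimodule_E ext_centralizer_iff\<close>)
  then show ?thesis
    using nested_mult_eq_ext_map[OF x]
    by (auto simp: bimodule_hom_def S.B.lact_closed S.B.ract_closed Pi_iff)
qed

lemma nested_mult_one:
  assumes x: "x \<in> ext_centralizer A R \<rho> S \<phi>"
  shows "nested_mult A R \<rho> x (ext_pure A S \<phi> \<one>\<^bsub>A\<^esub> \<one>\<^bsub>A\<^esub>) = x"
  using x by (subst nested_mult_eq_ext_map[OF x]) (simp_all add: S.ext_map_one bimodule_E ext_centralizer_iff)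

text \<open>The product with \<open>x\<close> is a bimodule map, so it carries an element commuting
  with the image of \<open>V\<close> to another such element.\<close>

lemma nested_mult_closed:
  assumes "x \<in> ext_centralizer A R \<rho> S \<phi>" "y \<in> ext_centralizer A S \<phi> V \<psi>" "\<And>v. v \<in> carrier V \<Longrightarrow> \<psi> v \<in> carrier A"
  shows "nested_mult A R \<rho> x y \<in> ext_centralizer A R \<rho> V \<psi>"
  using assms bimodule_homD(1,3,4)[OF nested_mult_hom[OF assms(1)]]
  by (simp add: ext_centralizer_iff flip: bimodule_homD(3,4)[OF nested_mult_hom[OF assms(1)]])

lemma nested_mult_add_right:
  assumes "x \<in> ext_centralizer A R \<rho> S \<phi>" "y \<in> carrier (ext_tensor A S \<phi>)" "z \<in> carrier (ext_tensor A S \<phi>)"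
  shows "nested_mult A R \<rho> x (y \<oplus>\<^bsub>ext_tensor A S \<phi>\<^esub> z) = nested_mult A R \<rho> x y \<oplus>\<^bsub>E\<^esub> nested_mult A R \<rho> x z"
  using nested_mult_hom[OF assms(1)] assms(2,3) by (simp add: bimodule_hom_def)

lemma central_zero: "\<zero>\<^bsub>E\<^esub> \<in> ext_centralizer A R \<rho> S \<phi>"
  and central_add: "\<lbrakk>x \<in> ext_centralizer A R \<rho> S \<phi>; y \<in> ext_centralizer A R \<rho> S \<phi>\<rbrakk>
    \<Longrightarrow> x \<oplus>\<^bsub>E\<^esub> y \<in> ext_centralizer A R \<rho> S \<phi>"
  and central_minus: "x \<in> ext_centralizer A R \<rho> S \<phi> \<Longrightarrow> \<ominus>\<^bsub>E\<^esub> x \<in> ext_centralizer A R \<rho> S \<phi>"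
  by (auto simp: ext_centralizer_iff B.act_zero_minus B.lact_add_right B.ract_add_left)

text \<open>Both sides are bimodule maps in \<open>z\<close> that send \<open>1 \<otimes> 1\<close>
  to the sum of \<open>x\<close> and \<open>y\<close>.\<close>

lemma nested_mult_add_left:
  assumes x: "x \<in> ext_centralizer A R \<rho> S \<phi>" and y: "y \<in> ext_centralizer A R \<rho> S \<phi>"
    and z: "z \<in> carrier (ext_tensor A S \<phi>)"
  shows "nested_mult A R \<rho> (x \<oplus>\<^bsub>E\<^esub> y) z = nested_mult A R \<rho> x z \<oplus>\<^bsub>E\<^esub> nested_mult A R \<rho> y z"
proof (rule S.bimodule_hom_eqI[OF bimodule_E nested_mult_hom[OF central_add[OF x y]] _ _ z])
  show "(\<lambda>z. nested_mult A R \<rho> x z \<oplus>\<^bsub>E\<^esub> nested_mult A R \<rho> y z) \<in> bimodule_hom A A (ext_tensor A S \<phi>) E"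
    using nested_mult_hom[OF x] nested_mult_hom[OF y]
    by (simp add: bimodule_hom_def Pi_iff B.lact_add_right B.ract_add_left B.a_ac)
qed (simp add: nested_mult_one x y central_add)

lemma abelian_group_central:
  assumes "carrier H = ext_centralizer A R \<rho> S \<phi>" "ring.add H = ring.add E" "\<zero>\<^bsub>H\<^esub> = \<zero>\<^bsub>E\<^esub>"
  shows "abelian_group H"
  by (rule abelian_group_of_subset[OF B.abelian_group_axioms _ _ _ _ assms])
    (auto simp: ext_centralizer_closed central_zero central_add central_minus)

end

text \<open>The product with \<open>1 \<otimes> 1\<close> and the identity are bimodule maps with
  the same value at \<open>1 \<otimes> 1\<close>.\<close>

lemma one_nested_mult:
  assumes "y \<in> carrier E"
  shows "nested_mult A R \<rho> (pt \<one>\<^bsub>A\<^esub> \<one>\<^bsub>A\<^esub>) y = y"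
  using bimodule_hom_eqI[OF bimodule_E nested_mult_hom[OF ring_extension_axioms one_central] id_hom _ assms]
    nested_mult_one[OF ring_extension_axioms one_central] by simp

text \<open>Both sides are bimodule maps in \<open>z\<close> that send \<open>1 \<otimes> 1\<close>
  to the product of \<open>x\<close> and \<open>y\<close>. Allowing three base rings covers at once
  the ring multiplications, the module actions and the mixed laws of the Morita context.\<close>

lemma nested_mult_assoc:
  assumes S: "ring_extension A S \<phi>" and V: "ring_extension A V \<psi>"
    and x: "x \<in> ext_centralizer A R \<rho> S \<phi>" and y: "y \<in> ext_centralizer A S \<phi> V \<psi>"
    and z: "z \<in> carrier (ext_tensor A V \<psi>)"
  shows "nested_mult A R \<rho> (nested_mult A R \<rho> x y) z = nested_mult A R \<rho> x (nested_mult A S \<phi> y z)"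
proof -
  interpret S: ring_extension A S \<phi> by (rule S)
  interpret V: ring_extension A V \<psi> by (rule V)
  have xy: "nested_mult A R \<rho> x y \<in> ext_centralizer A R \<rho> V \<psi>"
    by (rule nested_mult_closed[OF S x y]) simp
  have hom: "(\<lambda>z. nested_mult A R \<rho> x (nested_mult A S \<phi> y z)) \<in> bimodule_hom A A (ext_tensor A V \<psi>) E"
    by (rule bimodule_hom_comp[OF S.nested_mult_hom[OF V y] nested_mult_hom[OF S x]])
  show ?thesis
    by (rule V.bimodule_hom_eqI[OF bimodule_E nested_mult_hom[OF V xy] hom _ z])
      (simp add: nested_mult_one[OF V xy] S.nested_mult_one[OF V y])
qed

section \<open>The centralizers as rings and bimodules, and their Morita context\<close>

lemma centralizer_ring_simps:
  "carrier (centralizer_ring A R \<rho>) = ext_centralizer A R \<rho> R \<rho>"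
  "ring.add (centralizer_ring A R \<rho>) = ring.add E"
  "\<zero>\<^bsub>centralizer_ring A R \<rho>\<^esub> = \<zero>\<^bsub>E\<^esub>"
  "monoid.mult (centralizer_ring A R \<rho>) = nested_mult A R \<rho>"
  "\<one>\<^bsub>centralizer_ring A R \<rho>\<^esub> = pt \<one>\<^bsub>A\<^esub> \<one>\<^bsub>A\<^esub>"
  by (simp_all add: centralizer_ring_def)

lemma centralizer_bimodule_simps:
  "carrier (centralizer_bimodule A R \<rho> S \<phi>) = ext_centralizer A R \<rho> S \<phi>"
  "ring.add (centralizer_bimodule A R \<rho> S \<phi>) = ring.add E"
  "\<zero>\<^bsub>centralizer_bimodule A R \<rho> S \<phi>\<^esub> = \<zero>\<^bsub>E\<^esub>"
  "lact (centralizer_bimodule A R \<rho> S \<phi>) = nested_mult A R \<rho>"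
  "ract (centralizer_bimodule A R \<rho> S \<phi>) = nested_mult A R \<rho>"
  by (simp_all add: centralizer_bimodule_def)

lemma hom_closed_A: "r \<in> carrier R \<Longrightarrow> \<rho> r \<in> carrier A"
  by simp

lemma ring_centralizer_ring: "ring (centralizer_ring A R \<rho>)"
proof (rule ringI)
  note R = ring_extension_axioms
  note simps = centralizer_ring_simps nested_mult_closed[OF R _ _ hom_closed_A] ext_centralizer_closed
    nested_mult_assoc[OF R R] nested_mult_one[OF R] one_nested_mult one_central nested_mult_add_left[OF R]
    nested_mult_add_right[OF R] central_add[OF R]
  show "abelian_group (centralizer_ring A R \<rho>)"
    by (rule abelian_group_central[OF R]) (simp_all add: simps)
  show "Group.monoid (centralizer_ring A R \<rho>)"
    by (rule monoidI) (simp_all add: simps)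
qed (simp_all add: centralizer_ring_simps ext_centralizer_closed nested_mult_add_left[OF ring_extension_axioms] nested_mult_add_right[OF ring_extension_axioms])

text \<open>Each module axiom is an additivity, associativity or unit law of
  \<open>nested_mult\<close>, with \<open>R\<close> and \<open>S\<close> in suitable
  positions.\<close>

lemma bimodule_centralizer:
  assumes S: "ring_extension A S \<phi>"
  shows "bimodule (centralizer_ring A R \<rho>) (centralizer_ring A S \<phi>) (centralizer_bimodule A R \<rho> S \<phi>)"
proof -
  interpret S: ring_extension A S \<phi> by (rule S)
  note R = ring_extension_axioms
  note simps = centralizer_ring_simps S.centralizer_ring_simps centralizer_bimodule_simps
    nested_mult_closed[OF R _ _ S.hom_closed_A] nested_mult_closed[OF S _ _ S.hom_closed_A]
    nested_mult_add_left[OF R] nested_mult_add_right[OF R]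
    nested_mult_add_left[OF S] nested_mult_add_right[OF S] ext_centralizer_closed
    nested_mult_assoc[OF R R] nested_mult_assoc[OF S S] nested_mult_assoc[OF R S]
    nested_mult_one[OF S] one_nested_mult
  have "abelian_group (centralizer_bimodule A R \<rho> S \<phi>)"
    by (rule abelian_group_central[OF S]) (simp_all add: simps)
  then show ?thesis
    by (intro bimodule.intro bimodule_axioms.intro ring_centralizer_ring S.ring_centralizer_ring)
      (simp_all add: simps)
qed

text \<open>Balancedness over the middle ring is the associativity
  \<open>(p u) q = p (u q)\<close>.\<close>

lemma balanced_nested_mult:
  assumes S: "ring_extension A S \<phi>"
  shows "balanced (centralizer_ring A S \<phi>) (centralizer_bimodule A R \<rho> S \<phi>)
    (centralizer_bimodule A S \<phi> R \<rho>) (centralizer_ring A R \<rho>) (nested_mult A R \<rho>)"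
proof -
  interpret S: ring_extension A S \<phi> by (rule S)
  show ?thesis
    unfolding balanced_def
    by (simp add: centralizer_ring_simps S.centralizer_ring_simps centralizer_bimodule_simps
      S.centralizer_bimodule_simps nested_mult_closed[OF S _ _ hom_closed_A] nested_mult_add_left[OF S]
      nested_mult_add_right[OF S] nested_mult_assoc[OF S S] ext_centralizer_closed)
qed

lemma tensor_pair_centralizers:
  assumes S: "ring_extension A S \<phi>"
  shows "tensor_pair (centralizer_ring A R \<rho>) (centralizer_ring A S \<phi>) (centralizer_ring A R \<rho>)
    (centralizer_bimodule A R \<rho> S \<phi>) (centralizer_bimodule A S \<phi> R \<rho>)"
  by (intro tensor_pair.intro bimodule_centralizer S ring_extension.bimodule_centralizer[OF S] ring_extension_axioms)

lemma lift_nested_mult_pure: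
  assumes S: "ring_extension A S \<phi>"
    and "p \<in> carrier (centralizer_bimodule A R \<rho> S \<phi>)" "q \<in> carrier (centralizer_bimodule A S \<phi> R \<rho>)"
  shows "tensor_lift (centralizer_ring A R \<rho>) (nested_mult A R \<rho>)
    (pure_tensor (centralizer_ring A S \<phi>) (centralizer_bimodule A R \<rho> S \<phi>) (centralizer_bimodule A S \<phi> R \<rho>) p q)
    = nested_mult A R \<rho> p q"
  by (rule tensor_pair.lift_pure[OF tensor_pair_centralizers[OF S] _ balanced_nested_mult[OF S] assms(2,3)])
    (rule ring.is_abelian_group[OF ring_centralizer_ring])

text \<open>Linearity over the centralizer ring is \<open>(t p) q = t (p q)\<close> and
  \<open>p (q t) = (p q) t\<close> on pure tensors, extended by additivity.\<close>

lemma lift_nested_mult_hom: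
  assumes S: "ring_extension A S \<phi>"
  shows "tensor_lift (centralizer_ring A R \<rho>) (nested_mult A R \<rho>)
    \<in> bimodule_hom (centralizer_ring A R \<rho>) (centralizer_ring A R \<rho>)
        (tensor (centralizer_ring A S \<phi>) (centralizer_bimodule A R \<rho> S \<phi>) (centralizer_bimodule A S \<phi> R \<rho>))
        (regular_bimodule (centralizer_ring A R \<rho>))"
proof -
  interpret S: ring_extension A S \<phi> by (rule S)
  let ?T = "centralizer_ring A R \<rho>" and ?U = "centralizer_ring A S \<phi>"
  let ?P = "centralizer_bimodule A R \<rho> S \<phi>" and ?Q = "centralizer_bimodule A S \<phi> R \<rho>"
  let ?\<mu> = "tensor_lift ?T (nested_mult A R \<rho>)"
  note R = ring_extension_axioms
  interpret tp: tensor_pair ?T ?U ?T ?P ?Q by (rule tensor_pair_centralizers[OF S])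
  interpret \<mu>: abelian_group_hom "tensor ?U ?P ?Q" ?T ?\<mu>
    by (rule tp.tensor_lift_hom[OF _ balanced_nested_mult[OF S]])
      (rule ring.is_abelian_group[OF ring_centralizer_ring])
  interpret bt: bimodule ?T ?T "tensor ?U ?P ?Q" by (rule tp.bimodule_tensor)
  have 1: "?\<mu> (lact (tensor ?U ?P ?Q) t z) = t \<otimes>\<^bsub>?T\<^esub> ?\<mu> z"
    if "z \<in> carrier (tensor ?U ?P ?Q)" and t: "t \<in> carrier ?T" for t z
    using that(1)
  proof (induction z rule: tp.tensor_induct)
    case (pure p q)
    then have "?\<mu> (lact (tensor ?U ?P ?Q) t (pure_tensor ?U ?P ?Q p q)) = nested_mult A R \<rho> (nested_mult A R \<rho> t p) q"
      using t tp.M.lact_closed[OF t pure(1)] by (simp add: tp.lact_pure lift_nested_mult_pure[OF S])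
         (simp add: centralizer_bimodule_simps)
    also have "\<dots> = t \<otimes>\<^bsub>?T\<^esub> nested_mult A R \<rho> p q"
      using t pure by (subst nested_mult_assoc[OF R S])
        (simp_all add: centralizer_ring_simps centralizer_bimodule_simps S.centralizer_bimodule_simps ext_centralizer_closed)
    finally show ?case using pure by (simp add: lift_nested_mult_pure[OF S])
  next
    case (add x y)
    then show ?case using t by (simp add: bt.lact_add_right bt.lact_closed tp.M.R.r_distr)
  qed
  have 2: "?\<mu> (ract (tensor ?U ?P ?Q) z t) = ?\<mu> z \<otimes>\<^bsub>?T\<^esub> t"
    if "z \<in> carrier (tensor ?U ?P ?Q)" and t: "t \<in> carrier ?T" for t z
    using that(1)
  proof (induction z rule: tp.tensor_induct)
    case (pure p q)
    then have "?\<mu> (ract (tensor ?U ?P ?Q) (pure_tensor ?U ?P ?Q p q) t) = nested_mult A R \<rho> p (nested_mult A S \<phi> q t)"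
      using t tp.N.ract_closed[OF pure(2) t] by (simp add: tp.ract_pure lift_nested_mult_pure[OF S])
         (simp add: S.centralizer_bimodule_simps)
    also have "\<dots> = nested_mult A R \<rho> p q \<otimes>\<^bsub>?T\<^esub> t"
      using t pure by (subst nested_mult_assoc[OF S R, symmetric])
        (simp_all add: centralizer_ring_simps centralizer_bimodule_simps S.centralizer_bimodule_simps ext_centralizer_closed)
    finally show ?case using pure by (simp add: lift_nested_mult_pure[OF S])
  next
    case (add x y)
    then show ?case using t by (simp add: bt.ract_add_left bt.ract_closed tp.M.R.l_distr)
  qed
  show ?thesis
    using 1 2 \<mu>.hom_closed \<mu>.hom_add by (simp add: bimodule_hom_def regular_bimodule_def)
qed

text \<open>Once the lifts are evaluated on pure tensors, the two compatibility laws become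
  associativity of \<open>nested_mult\<close> with the base rings alternating.\<close>

lemma centralizer_morita_context:
  assumes S: "ring_extension A S \<phi>"
  shows "morita_context (centralizer_ring A R \<rho>) (centralizer_ring A S \<phi>)
    (centralizer_bimodule A R \<rho> S \<phi>) (centralizer_bimodule A S \<phi> R \<rho>)
    (tensor_lift (centralizer_ring A R \<rho>) (nested_mult A R \<rho>))
    (tensor_lift (centralizer_ring A S \<phi>) (nested_mult A S \<phi>))"
proof -
  interpret S: ring_extension A S \<phi> by (rule S)
  note R = ring_extension_axioms
  note lifts = lift_nested_mult_pure[OF S] S.lift_nested_mult_pure[OF R]
  note simps = centralizer_bimodule_simps S.centralizer_bimodule_simps ext_centralizer_closed
    nested_mult_assoc[OF S R] S.nested_mult_assoc[OF R S]
  show ?thesis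
    unfolding morita_context_def
    by (intro conjI ballI ring_centralizer_ring S.ring_centralizer_ring bimodule_centralizer[OF S]
        S.bimodule_centralizer[OF R] lift_nested_mult_hom[OF S] S.lift_nested_mult_hom[OF R])
      (unfold lifts; simp add: simps)+
qed

end

section \<open>Surjectivity in Morita contexts\<close>

text \<open>The two sides of a context play symmetric roles, so a result about \<open>\<mu>\<close>
  also yields one about \<open>\<nu>\<close>.\<close>

lemma morita_context_swap: "morita_context T U P Q \<mu> \<nu> \<Longrightarrow> morita_context U T Q P \<nu> \<mu>"
  by (simp add: morita_context_def)

text \<open>The identity \<open>\<mu>(z) w = z \<mu>(w)\<close>, taken at \<open>w = e\<close>,
  recovers \<open>z\<close> from \<open>\<mu>(z)\<close>; linearity of \<open>\<mu>\<close> gives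
  surjectivity.\<close>

lemma morita_context_iso:
  assumes ctx: "morita_context T U P Q \<mu> \<nu>"
    and e: "e \<in> carrier (tensor U P Q)" and one: "\<mu> e = \<one>\<^bsub>T\<^esub>"
  shows "\<mu> \<in> bimodule_iso T T (tensor U P Q) (regular_bimodule T)"
proof -
  have \<mu>: "\<mu> \<in> bimodule_hom T T (tensor U P Q) (regular_bimodule T)"
    and \<nu>: "\<nu> \<in> bimodule_hom U U (tensor T Q P) (regular_bimodule U)"
    and P: "bimodule T U P" and Q: "bimodule U T Q"
    and pqp: "\<And>p q p'. \<lbrakk>p \<in> carrier P; q \<in> carrier Q; p' \<in> carrier P\<rbrakk> \<Longrightarrow>
      ract P p (\<nu> (pure_tensor T Q P q p')) = lact P (\<mu> (pure_tensor U P Q p q)) p'"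
    and qpq: "\<And>q p q'. \<lbrakk>q \<in> carrier Q; p \<in> carrier P; q' \<in> carrier Q\<rbrakk> \<Longrightarrow>
        ract Q q (\<mu> (pure_tensor U P Q p q')) = lact Q (\<nu> (pure_tensor T Q P q p)) q'"
    using ctx by (simp_all add: morita_context_def)
  interpret PQ: tensor_pair T U T P Q by (intro tensor_pair.intro P Q)
  interpret QP: tensor_pair U T U Q P by (intro tensor_pair.intro P Q)
  interpret bi: bimodule T T "tensor U P Q" by (rule PQ.bimodule_tensor)
  note \<mu>h = bimodule_homD[OF \<mu>, simplified regular_bimodule_def, simplified]
  note \<nu>h = bimodule_homD[OF \<nu>, simplified regular_bimodule_def, simplified]
  \<comment> \<open>On pure tensors: \<open>(p q) p' \<otimes> q' = p (q p') \<otimes> q' = p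
    \<otimes> (q p') q' = p \<otimes> q (p' q')\<close>, using both compatibility laws and
    balancedness over \<open>U\<close>.\<close>
  have key: "lact (tensor U P Q) (\<mu> z) w = ract (tensor U P Q) z (\<mu> w)"
    if "z \<in> carrier (tensor U P Q)" "w \<in> carrier (tensor U P Q)" for z w
    using that
  proof (induction z rule: PQ.tensor_induct)
    case (pure p q)
    note p = pure(1) and q = pure(2)
    show ?case
      using \<open>w \<in> carrier (tensor U P Q)\<close>
    proof (induction w rule: PQ.tensor_induct)
      case (pure p' q')
      then show ?case
        using p q by (simp add: PQ.lact_pure PQ.ract_pure \<mu>h(1) qpq flip: pqp)
          (simp add: PQ.pure_balance \<nu>h(1))
    next
      case (add x y)
      then show ?case using p q by (simp add: \<mu>h(1,2) bi.lact_add_right bi.ract_add_right)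
    qed
  next
    case (add x y)
    then show ?case by (simp add: \<mu>h(1,2) bi.lact_add_left bi.ract_add_left)
  qed
  have rec: "z = lact (tensor U P Q) (\<mu> z) e" if "z \<in> carrier (tensor U P Q)" for z
    using key[OF that e] that by (simp add: one bi.ract_one)
  have "inj_on \<mu> (carrier (tensor U P Q))"
    by (rule inj_onI) (metis rec)
  \<comment> \<open>The preimage of \<open>t\<close> is \<open>t e\<close>, since
    \<open>\<mu>(t e) = t \<mu>(e) = t\<close>.\<close>
  moreover have "t \<in> \<mu> ` carrier (tensor U P Q)" if "t \<in> carrier T" for t
    using \<mu>h(3)[OF that e] that e one bi.lact_closed by (intro image_eqI[of _ _ "lact (tensor U P Q) t e"]) simp_all
  ultimately have "bij_betw \<mu> (carrier (tensor U P Q)) (carrier T)"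
    using \<mu>h(1) by (auto simp: bij_betw_def)
  then show ?thesis using \<mu> by (simp add: bimodule_iso_def regular_bimodule_def)
qed

section \<open>H-separable extensions\<close>

lemma bimodule_power_simps:
  "carrier (bimodule_power N M) = {..<N} \<rightarrow>\<^sub>E carrier M"
  "x \<oplus>\<^bsub>bimodule_power N M\<^esub> y = (\<lambda>i\<in>{..<N}. x i \<oplus>\<^bsub>M\<^esub> y i)"
  "\<zero>\<^bsub>bimodule_power N M\<^esub> = (\<lambda>i\<in>{..<N}. \<zero>\<^bsub>M\<^esub>)"
  "lact (bimodule_power N M) r x = (\<lambda>i\<in>{..<N}. lact M r (x i))"
  "ract (bimodule_power N M) x s = (\<lambda>i\<in>{..<N}. ract M (x i) s)"
  by (simp_all add: bimodule_power_def)

lemma bimodule_power: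
  assumes "bimodule R S M"
  shows "bimodule R S (bimodule_power N M)"
proof -
  interpret bimodule R S M by fact
  have mem: "x i \<in> carrier M" if "x \<in> {..<N} \<rightarrow>\<^sub>E carrier M" "i < N" for x i
    using that by auto
  \<comment> \<open>Elements of the power are extensional functions, so the laws that return
    \<open>x\<close> itself also have to be checked outside the index range.\<close>
  have undef: "x i = undefined" if "x \<in> {..<N} \<rightarrow>\<^sub>E carrier M" "\<not> i < N" for x i
    using that by auto
  have "abelian_group (bimodule_power N M)"
  proof (rule abelian_groupI)
    fix x y assume x: "x \<in> carrier (bimodule_power N M)" and y: "y \<in> carrier (bimodule_power N M)"
    show "x \<oplus>\<^bsub>bimodule_power N M\<^esub> y \<in> carrier (bimodule_power N M)"
      using x y by (simp add: bimodule_power_simps mem restrict_PiE_iff)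
    show "x \<oplus>\<^bsub>bimodule_power N M\<^esub> y = y \<oplus>\<^bsub>bimodule_power N M\<^esub> x"
      using x y by (simp add: bimodule_power_simps fun_eq_iff mem M.a_comm)
    fix z assume z: "z \<in> carrier (bimodule_power N M)"
    show "(x \<oplus>\<^bsub>bimodule_power N M\<^esub> y) \<oplus>\<^bsub>bimodule_power N M\<^esub> z
      = x \<oplus>\<^bsub>bimodule_power N M\<^esub> (y \<oplus>\<^bsub>bimodule_power N M\<^esub> z)"
      using x y z by (simp add: bimodule_power_simps fun_eq_iff mem M.a_assoc)
  next
    fix x assume x: "x \<in> carrier (bimodule_power N M)"
    show "\<exists>y \<in> carrier (bimodule_power N M). y \<oplus>\<^bsub>bimodule_power N M\<^esub> x = \<zero>\<^bsub>bimodule_power N M\<^esub>"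
    proof (rule bexI)
      show "(\<lambda>i\<in>{..<N}. \<ominus>\<^bsub>M\<^esub> x i) \<oplus>\<^bsub>bimodule_power N M\<^esub> x = \<zero>\<^bsub>bimodule_power N M\<^esub>"
        using x by (simp add: bimodule_power_simps fun_eq_iff mem M.l_neg)
    qed (use x in \<open>simp add: bimodule_power_simps mem restrict_PiE_iff\<close>)
    show "\<zero>\<^bsub>bimodule_power N M\<^esub> \<oplus>\<^bsub>bimodule_power N M\<^esub> x = x"
      using x by (simp add: bimodule_power_simps fun_eq_iff mem undef restrict_def)
  qed (simp add: bimodule_power_simps restrict_PiE_iff)
  then show ?thesis
    by (intro bimodule.intro bimodule_axioms.intro R.ring_axioms S.ring_axioms)
      (simp_all add: bimodule_power_simps fun_eq_iff restrict_PiE_iff mem undef lact_closed ract_closed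
        lact_add_left lact_add_right ract_add_left ract_add_right lact_mult ract_mult lact_one ract_one
        lact_ract)
qed

section \<open>Direct summands as split bimodule maps\<close>

lemma (in abelian_group) minus_eq_zeroD:
  assumes "x \<ominus> y = \<zero>" "x \<in> carrier G" "y \<in> carrier G"
  shows "x = y"
proof -
  have "x = (x \<ominus> y) \<oplus> y" using assms(2,3) by (simp add: a_minus_def a_assoc l_neg)
  then show ?thesis unfolding assms(1) using assms(3) by simp
qed

text \<open>The difference of \<open>d\<close> and \<open>d'\<close> equals that of
  \<open>e'\<close> and \<open>e\<close>, hence lies in both subgroups and vanishes.\<close>

lemma (in abelian_group) sum_zero_unique:
  assumes "additive_subgroup D G" "additive_subgroup E G" "D \<inter> E = {\<zero>}"
    and "d \<in> D" "d' \<in> D" "e \<in> E" "e' \<in> E" "d \<oplus> e = d' \<oplus> e'"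
  shows "d = d'"
proof -
  interpret D: additive_subgroup D G by fact
  interpret E: additive_subgroup E G by fact
  have cl: "d \<in> carrier G" "d' \<in> carrier G" "e \<in> carrier G" "e' \<in> carrier G"
    using assms D.a_subset E.a_subset by auto
  have cancel: "(x \<oplus> z) \<ominus> (y \<oplus> z) = x \<ominus> y" if "x \<in> carrier G" "y \<in> carrier G" "z \<in> carrier G" for x y z
    using that by (simp add: a_minus_def minus_add a_ac r_neg)
  have "d \<ominus> d' = (d' \<oplus> e') \<ominus> (d' \<oplus> e)"
    using cancel[OF cl(1,2,3)] assms(8) by simp
  also have "\<dots> = e' \<ominus> e"
    using cancel[OF cl(4,3,2)] cl by (simp add: a_comm)
  finally have eq: "d \<ominus> d' = e' \<ominus> e" .
  have "d \<ominus> d' \<in> D" "e' \<ominus> e \<in> E"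
    using assms(4-7) by (simp_all add: a_minus_def D.a_closed E.a_closed D.a_inv_closed E.a_inv_closed)
  then have "d \<ominus> d' \<in> D \<inter> E" using eq by simp
  then have "d \<ominus> d' = \<zero>" unfolding assms(3) by simp
  then show ?thesis using cl minus_eq_zeroD by blast
qed

text \<open>Replaces the complement by a retraction: \<open>\<phi>\<close> is the isomorphism onto
  the summand \<open>D\<close>, and \<open>\<psi>\<close> projects onto \<open>D\<close> along
  \<open>E\<close> and then inverts \<open>\<phi>\<close>.\<close>

lemma iso_to_direct_summand_split:
  assumes "bimodule R S L" "bimodule R S M" "iso_to_direct_summand R S L M"
  obtains \<phi> \<psi> where "\<phi> \<in> bimodule_hom R S L M" "\<psi> \<in> bimodule_hom R S M L"
    "\<And>x. x \<in> carrier L \<Longrightarrow> \<psi> (\<phi> x) = x"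
proof -
  interpret L: bimodule R S L by fact
  interpret M: bimodule R S M by fact
  obtain D E \<phi> where D: "subbimodule R S D M" and E: "subbimodule R S E M"
    and DE: "D \<inter> E = {\<zero>\<^bsub>M\<^esub>}" "D <+>\<^bsub>M\<^esub> E = carrier M"
    and \<phi>: "\<phi> \<in> bimodule_iso R S L (M\<lparr>carrier := D\<rparr>)"
    using assms(3) unfolding iso_to_direct_summand_def direct_summand_def by blast
  interpret D: additive_subgroup D M using D by (simp add: subbimodule_def)
  interpret E: additive_subgroup E M using E by (simp add: subbimodule_def)
  have "\<phi> \<in> bimodule_hom R S L (M\<lparr>carrier := D\<rparr>)" using \<phi> by (simp add: bimodule_iso_def)
  note \<phi>h' = bimodule_homD[OF this, simplified partial_object.simps ring.simps bimodule.simps]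
  note \<phi>D = \<phi>h'(1)
  have \<phi>h: "\<phi> \<in> bimodule_hom R S L M"
    using \<phi>h' D.a_subset by (simp add: bimodule_hom_def Pi_iff subset_iff)
  have bij: "bij_betw \<phi> (carrier L) D" using \<phi> by (simp add: bimodule_iso_def)
  \<comment> \<open>The description is well defined because the decomposition along \<open>D\<close>
    and \<open>E\<close> is unique and \<open>\<phi>\<close> is injective.\<close>
  define \<psi> where "\<psi> w = (THE x. x \<in> carrier L \<and> (\<exists>e \<in> E. w = \<phi> x \<oplus>\<^bsub>M\<^esub> e))" for w
  have ex: "\<exists>x \<in> carrier L. \<exists>e \<in> E. w = \<phi> x \<oplus>\<^bsub>M\<^esub> e" if w: "w \<in> carrier M" for w
  proof -
    have "w \<in> D <+>\<^bsub>M\<^esub> E" using w DE(2) by simp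
    then obtain d e where "d \<in> D" "e \<in> E" "w = d \<oplus>\<^bsub>M\<^esub> e"
      unfolding set_add_defs by auto
    then show ?thesis using bij unfolding bij_betw_def by blast
  qed
  have \<psi>_eq: "\<psi> (\<phi> x \<oplus>\<^bsub>M\<^esub> e) = x" if "x \<in> carrier L" "e \<in> E" for x e
    unfolding \<psi>_def
  proof (rule the_equality)
    show "x \<in> carrier L \<and> (\<exists>e' \<in> E. \<phi> x \<oplus>\<^bsub>M\<^esub> e = \<phi> x \<oplus>\<^bsub>M\<^esub> e')" using that by blast
    fix y assume y: "y \<in> carrier L \<and> (\<exists>e' \<in> E. \<phi> x \<oplus>\<^bsub>M\<^esub> e = \<phi> y \<oplus>\<^bsub>M\<^esub> e')"
    then obtain e' where e': "e' \<in> E" "\<phi> x \<oplus>\<^bsub>M\<^esub> e = \<phi> y \<oplus>\<^bsub>M\<^esub> e'" by blast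
    have "\<phi> x = \<phi> y"
      by (rule M.sum_zero_unique[OF D.additive_subgroup_axioms E.additive_subgroup_axioms DE(1) _ _ _ _ e'(2)])
        (use that y e' \<phi>D in auto)
    then show "y = x" using bij that y by (auto simp: bij_betw_def dest: inj_onD)
  qed
  have \<phi>cl: "\<phi> x \<in> carrier M" if "x \<in> carrier L" for x by (rule bimodule_homD(1)[OF \<phi>h that])
  have Ecl: "e \<in> carrier M" if "e \<in> E" for e using that E.a_subset by auto
  have "\<psi> \<in> bimodule_hom R S M L"
    unfolding bimodule_hom_def
  proof (intro CollectI conjI ballI funcsetI)
    fix w assume w: "w \<in> carrier M"
    obtain x e where x: "x \<in> carrier L" "e \<in> E" "w = \<phi> x \<oplus>\<^bsub>M\<^esub> e" using ex[OF w] by blast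
    show "\<psi> w \<in> carrier L" using x by (simp add: \<psi>_eq)
    {
      fix w' assume w': "w' \<in> carrier M"
      obtain y f where y: "y \<in> carrier L" "f \<in> E" "w' = \<phi> y \<oplus>\<^bsub>M\<^esub> f" using ex[OF w'] by blast
      have "w \<oplus>\<^bsub>M\<^esub> w' = \<phi> (x \<oplus>\<^bsub>L\<^esub> y) \<oplus>\<^bsub>M\<^esub> (e \<oplus>\<^bsub>M\<^esub> f)"
        using x y by (simp add: bimodule_homD(2)[OF \<phi>h] \<phi>cl Ecl M.a_ac)
      then show "\<psi> (w \<oplus>\<^bsub>M\<^esub> w') = \<psi> w \<oplus>\<^bsub>L\<^esub> \<psi> w'"
        using x y by (simp add: \<psi>_eq E.a_closed)
    next
      fix r assume r: "r \<in> carrier R"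
      have "lact M r w = \<phi> (lact L r x) \<oplus>\<^bsub>M\<^esub> lact M r e"
        using x r by (simp add: bimodule_homD(3)[OF \<phi>h] \<phi>cl Ecl M.lact_add_right)
      moreover have "lact M r e \<in> E" using E r x unfolding subbimodule_def by blast
      ultimately show "\<psi> (lact M r w) = lact L r (\<psi> w)"
        using x r by (simp add: \<psi>_eq L.lact_closed)
    next
      fix s assume s: "s \<in> carrier S"
      have "ract M w s = \<phi> (ract L x s) \<oplus>\<^bsub>M\<^esub> ract M e s"
        using x s by (simp add: bimodule_homD(4)[OF \<phi>h] \<phi>cl Ecl M.ract_add_left)
      moreover have "ract M e s \<in> E" using E s x unfolding subbimodule_def by blast
      ultimately show "\<psi> (ract M w s) = ract L (\<psi> w) s"
        using x s by (simp add: \<psi>_eq L.ract_closed)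
    }
  qed
  moreover have "\<psi> (\<phi> x) = x" if "x \<in> carrier L" for x
    using \<psi>_eq[OF that E.zero_closed] \<phi>cl[OF that] by simp
  ultimately show thesis using that \<phi>h by blast
qed

text \<open>A form of Nakayama's lemma: multiplying the relations by suitable elements of \<open>1 - J\<close> removes
  the generators \<open>r i\<close> from the right-hand sides one at a time.\<close>

lemma (in ring) central_nakayama:
  fixes n :: nat
  assumes J: "J \<subseteq> carrier R" "\<zero> \<in> J" "\<And>x y. x \<in> J \<Longrightarrow> y \<in> J \<Longrightarrow> x \<oplus> y \<in> J"
      "\<And>x. x \<in> J \<Longrightarrow> \<ominus> x \<in> J" "\<And>x y. x \<in> J \<Longrightarrow> y \<in> J \<Longrightarrow> x \<otimes> y \<in> J"
    and central: "\<And>x y. x \<in> J \<Longrightarrow> y \<in> carrier R \<Longrightarrow> x \<otimes> y = y \<otimes> x"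
    and r: "\<And>i. i < n \<Longrightarrow> r i \<in> carrier R"
    and a: "\<And>i k. i < n \<Longrightarrow> k < n \<Longrightarrow> a i k \<in> J"
    and eq: "\<And>i. i < n \<Longrightarrow> r i = (\<Oplus>k\<in>{..<n}. r k \<otimes> a i k)"
  shows "\<exists>j \<in> J. \<forall>i < n. r i \<otimes> j = r i"
proof -
  \<comment> \<open>\<open>S m\<close> collects the combinations of the first \<open>m\<close>
    generators with coefficients in \<open>J\<close>.\<close>
  define S where "S m = {\<Oplus>k\<in>{..<m}. r k \<otimes> b k | b. \<forall>k < m. b k \<in> J}" for m
  have Jc: "x \<in> carrier R" if "x \<in> J" for x using that J(1) by auto
  have rc: "r k \<in> carrier R" if "k < m" "m \<le> n" for k m using that by (intro r) simp
  have SI: "(\<Oplus>k\<in>{..<m}. r k \<otimes> b k) \<in> S m" if "\<forall>k < m. b k \<in> J" for b m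
    using that unfolding S_def by blast
  have S_add: "x \<oplus> y \<in> S m" if x: "x \<in> S m" and y: "y \<in> S m" and m: "m \<le> n" for x y m
  proof -
    obtain b c where b: "\<forall>k < m. b k \<in> J" "x = (\<Oplus>k\<in>{..<m}. r k \<otimes> b k)"
      and c: "\<forall>k < m. c k \<in> J" "y = (\<Oplus>k\<in>{..<m}. r k \<otimes> c k)"
      using x y unfolding S_def by blast
    have "x \<oplus> y = (\<Oplus>k\<in>{..<m}. r k \<otimes> b k \<oplus> r k \<otimes> c k)"
      unfolding b c by (rule finsum_addf[symmetric]) (use b c rc m Jc in auto)
    also have "\<dots> = (\<Oplus>k\<in>{..<m}. r k \<otimes> (b k \<oplus> c k))"
      by (rule finsum_cong') (use b c rc m Jc in \<open>auto simp: r_distr\<close>)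
    finally show ?thesis using SI[of m "\<lambda>k. b k \<oplus> c k"] b c J(3) by simp
  qed
  \<comment> \<open>The condition on \<open>u\<close> is stated as stability of \<open>J\<close>
    because the lemma is applied both to an element of \<open>J\<close> and to an element of the
    form \<open>1 - (j + c)\<close>.\<close>
  have S_mult: "x \<otimes> u \<in> S m"
    if x: "x \<in> S m" and u: "u \<in> carrier R" "\<And>j. j \<in> J \<Longrightarrow> j \<otimes> u \<in> J" and m: "m \<le> n" for x u m
  proof -
    obtain b where b: "\<forall>k < m. b k \<in> J" "x = (\<Oplus>k\<in>{..<m}. r k \<otimes> b k)"
      using x unfolding S_def by blast
    have "x \<otimes> u = (\<Oplus>k\<in>{..<m}. r k \<otimes> b k \<otimes> u)"
      unfolding b by (rule finsum_ldistr) (use b rc m u Jc in auto)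
    also have "\<dots> = (\<Oplus>k\<in>{..<m}. r k \<otimes> (b k \<otimes> u))"
      by (rule finsum_cong') (use b rc m Jc u in \<open>auto simp: m_assoc\<close>)
    finally show ?thesis using SI[of m "\<lambda>k. b k \<otimes> u"] b u(2) by simp
  qed
  have S_closed: "x \<in> carrier R" if "x \<in> S m" "m \<le> n" for x m
    using that rc Jc unfolding S_def by (auto intro!: finsum_closed)
  have S_Suc: "\<exists>s \<in> S m. \<exists>b \<in> J. x = s \<oplus> r m \<otimes> b" if x: "x \<in> S (Suc m)" and m: "m < n" for x m
  proof -
    obtain b where b: "\<forall>k < Suc m. b k \<in> J" "x = (\<Oplus>k\<in>{..<Suc m}. r k \<otimes> b k)"
      using x unfolding S_def by blast
    have "x = (\<Oplus>k\<in>{..<m}. r k \<otimes> b k) \<oplus> r m \<otimes> b m"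
      unfolding b lessThan_Suc by (subst finsum_insert) (use b r m Jc in \<open>auto intro!: a_comm finsum_closed\<close>)
    then show ?thesis using SI[of m b] b(1) by auto
  qed
  \<comment> \<open>After \<open>d\<close> rounds the last \<open>d\<close> generators no longer
    occur on the right-hand sides.\<close>
  have main: "\<exists>j \<in> J. \<forall>i < n. r i \<otimes> (\<one> \<ominus> j) \<in> S (n - d)" if "d \<le> n" for d
    using that
  proof (induction d)
    case 0
    have "r i \<otimes> (\<one> \<ominus> \<zero>) \<in> S n" if "i < n" for i
      using that r SI[of n "a i"] a by (simp add: a_minus_def flip: eq[OF that])
    then show ?case using J(2) by auto
  next
    case (Suc d)
    define m where "m = n - Suc d"
    have m: "m < n" "n - d = Suc m" using Suc.prems by (auto simp: m_def)
    obtain j where j: "j \<in> J" "\<And>i. i < n \<Longrightarrow> r i \<otimes> (\<one> \<ominus> j) \<in> S (Suc m)"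
      using Suc m by auto
    obtain s c where s: "s \<in> S m" "c \<in> J" "r m \<otimes> (\<one> \<ominus> j) = s \<oplus> r m \<otimes> c"
      using S_Suc[OF j(2)[OF m(1)] m(1)] by blast
    \<comment> \<open>Moving \<open>r m c\<close> to the left in
      \<open>r m (1 - j) = s + r m c\<close> gives \<open>r m u = s\<close>, which involves only
      earlier generators.\<close>
    define u where "u = \<one> \<ominus> (j \<oplus> c)"
    have sc: "s \<in> carrier R" using S_closed[OF s(1)] m by simp
    have u: "u \<in> carrier R" using j s by (simp add: u_def Jc)
    have Ju: "x \<otimes> u \<in> J" if "x \<in> J" for x
    proof -
      have "x \<otimes> u = x \<oplus> \<ominus> (x \<otimes> (j \<oplus> c))"
        using that j s by (simp add: u_def a_minus_def r_distr r_minus Jc)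
      then show ?thesis using that j s J by simp
    qed
    have u_comm: "x \<otimes> u = u \<otimes> x" if "x \<in> carrier R" for x
      using that j s central[of "j \<oplus> c" x] J(3)[of j c]
      by (simp add: u_def a_minus_def l_distr r_distr l_minus r_minus Jc)
    have rm: "r m \<otimes> u = s"
    proof -
      have "r m \<otimes> u = r m \<otimes> (\<one> \<ominus> j) \<ominus> r m \<otimes> c"
        using j(1) s(2) r m by (simp add: u_def a_minus_def r_distr r_minus minus_add Jc a_assoc)
      also have "\<dots> = s" using s sc r m by (simp add: Jc a_minus_def a_assoc r_neg)
      finally show ?thesis .
    qed
    \<comment> \<open>Chosen so that \<open>1 - j' = (1 - j) u\<close>. Expanding gives
      \<open>j' = j + c + j u\<close>, which lies in \<open>J\<close>.\<close>
    define j' where "j' = \<one> \<ominus> (\<one> \<ominus> j) \<otimes> u"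
    have one_minus: "\<one> \<ominus> (\<one> \<ominus> x) = x" if "x \<in> carrier R" for x
      using that by (simp add: a_minus_def minus_add r_neg2)
    have step: "(\<one> \<ominus> (j \<oplus> c)) \<ominus> v = \<one> \<ominus> ((j \<oplus> c) \<oplus> v)" if "v \<in> carrier R" for v
      using that j(1) s(2) by (simp add: a_minus_def minus_add Jc a_ac)
    have "(\<one> \<ominus> j) \<otimes> u = u \<ominus> j \<otimes> u"
      using j u by (simp add: a_minus_def l_distr l_minus Jc)
    also have "\<dots> = \<one> \<ominus> ((j \<oplus> c) \<oplus> j \<otimes> u)"
      using step[of "j \<otimes> u"] j(1) u by (simp add: Jc flip: u_def)
    finally have "j' = (j \<oplus> c) \<oplus> j \<otimes> u"
      using j(1) s(2) u by (simp add: j'_def one_minus Jc)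
    then have j': "j' \<in> J" using J(3) j(1) s(2) Ju by simp
    have j'u: "\<one> \<ominus> j' = (\<one> \<ominus> j) \<otimes> u"
      using j(1) u by (simp add: j'_def one_minus Jc)
    \<comment> \<open>Multiplying \<open>r i (1 - j) = t + r m b\<close> by the central element
      \<open>u\<close> turns the last term into \<open>s b\<close>, so generator \<open>m\<close>
      disappears.\<close>
    have "r i \<otimes> (\<one> \<ominus> j') \<in> S m" if i: "i < n" for i
    proof -
      obtain t b where t: "t \<in> S m" "b \<in> J" "r i \<otimes> (\<one> \<ominus> j) = t \<oplus> r m \<otimes> b"
        using S_Suc[OF j(2)[OF i] m(1)] by blast
      have tc: "t \<in> carrier R" using S_closed[OF t(1)] m by simp
      have "r i \<otimes> (\<one> \<ominus> j') = (r i \<otimes> (\<one> \<ominus> j)) \<otimes> u"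
        using j u r i by (simp add: j'u m_assoc Jc)
      also have "\<dots> = t \<otimes> u \<oplus> (r m \<otimes> b) \<otimes> u"
        unfolding t using tc t u r m by (simp add: l_distr Jc)
      also have "(r m \<otimes> b) \<otimes> u = s \<otimes> b"
        using t u r m u_comm[of b] by (simp add: rm[symmetric] m_assoc Jc)
      finally show ?thesis
        using S_mult[OF t(1) u Ju] S_mult[OF s(1) Jc[OF t(2)]] J(5) t(2) m by (auto intro: S_add)
    qed
    then show ?case using j' m_def by blast
  qed
  \<comment> \<open>With all \<open>n\<close> generators eliminated, \<open>S 0\<close> contains
    only the empty sum, hence \<open>r i (1 - j) = 0\<close>.\<close>
  obtain j where j: "j \<in> J" "\<And>i. i < n \<Longrightarrow> r i \<otimes> (\<one> \<ominus> j) \<in> S 0"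
    using main[of n] by auto
  have "r i \<otimes> j = r i" if "i < n" for i
  proof -
    have "r i \<otimes> (\<one> \<ominus> j) = \<zero>" using j(2)[OF that] by (auto simp: S_def)
    then have "r i \<ominus> r i \<otimes> j = \<zero>" using that r j by (simp add: a_minus_def r_distr r_minus Jc)
    then show ?thesis using that r j minus_eq_zeroD[of "r i" "r i \<otimes> j"] by (simp add: Jc)
  qed
  then show ?thesis using j by blast
qed

section \<open>Finite sums under additive maps and double sums\<close>

lemma abelian_group_hom_finsum:
  assumes "abelian_group_hom G H f" and "finite I" and "\<And>i. i \<in> I \<Longrightarrow> g i \<in> carrier G"
  shows "f (finsum G g I) = finsum H (\<lambda>i. f (g i)) I"
proof -
  interpret abelian_group_hom G H f by fact
  show ?thesis
    using assms(2,3)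
  proof (induction I)
    case (insert i I)
    then have "g \<in> I \<rightarrow> carrier G" "(\<lambda>i. f (g i)) \<in> I \<rightarrow> carrier H" by auto
    then show ?case using insert by (simp add: G.finsum_insert H.finsum_insert G.finsum_closed)
  qed simp
qed

lemma (in abelian_monoid) finsum_finsum_swap:
  assumes "finite I" "finite K" "\<And>i k. i \<in> I \<Longrightarrow> k \<in> K \<Longrightarrow> g i k \<in> carrier G"
  shows "(\<Oplus>i\<in>I. \<Oplus>k\<in>K. g i k) = (\<Oplus>k\<in>K. \<Oplus>i\<in>I. g i k)"
  using assms(1,3)
proof (induction I)
  case (insert i I)
  have "(\<Oplus>i\<in>insert i I. \<Oplus>k\<in>K. g i k) = (\<Oplus>k\<in>K. g i k) \<oplus> (\<Oplus>k\<in>K. \<Oplus>i\<in>I. g i k)"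
    using insert by (subst finsum_insert) (auto intro!: finsum_closed)
  also have "\<dots> = (\<Oplus>k\<in>K. g i k \<oplus> (\<Oplus>i\<in>I. g i k))"
    using insert by (intro finsum_addf[symmetric]) (auto intro!: finsum_closed)
  also have "\<dots> = (\<Oplus>k\<in>K. \<Oplus>i\<in>insert i I. g i k)"
    using insert by (intro finsum_cong') (auto intro!: finsum_closed simp: finsum_insert)
  finally show ?case .
qed (simp add: finsum_zero)

section \<open>Elements supplied by H-separability, and separability\<close>

context ring_extension
begin

text \<open>With a splitting \<open>\<psi> \<circ> \<phi> = id\<close> through the power of
  \<open>A\<close>, the \<open>r i\<close> are the coordinates of
  \<open>\<phi>(1 \<otimes> 1)\<close> and the \<open>e i\<close> are the images under
  \<open>\<psi>\<close> of the unit vectors. The former commute with \<open>R\<close> because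
  \<open>1 \<otimes> 1\<close> does, the latter with \<open>A\<close> because unit vectors
  do.\<close>

lemma H_separable_elements:
  assumes "H_separable A R \<rho>"
  obtains N :: nat and r e where
    "\<And>i. i < N \<Longrightarrow> r i \<in> carrier A"
    "\<And>i c. i < N \<Longrightarrow> c \<in> carrier R \<Longrightarrow> \<rho> c \<otimes>\<^bsub>A\<^esub> r i = r i \<otimes>\<^bsub>A\<^esub> \<rho> c"
    "\<And>i. i < N \<Longrightarrow> e i \<in> ext_centralizer A R \<rho> A id"
    "pt \<one>\<^bsub>A\<^esub> \<one>\<^bsub>A\<^esub> = (\<Oplus>\<^bsub>E\<^esub>i\<in>{..<N}. lact E (r i) (e i))"
proof -
  obtain N :: nat where N: "iso_to_direct_summand A A E (bimodule_power N (regular_bimodule A))"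
    using assms unfolding H_separable_def by blast
  let ?M = "bimodule_power N (regular_bimodule A)"
  have M: "bimodule A A ?M" by (rule bimodule_power[OF S.bimodule_regular])
  interpret M: bimodule A A ?M by (rule M)
  obtain \<phi> \<psi> where \<phi>: "\<phi> \<in> bimodule_hom A A E ?M" and \<psi>: "\<psi> \<in> bimodule_hom A A ?M E"
    and split: "\<And>x. x \<in> carrier E \<Longrightarrow> \<psi> (\<phi> x) = x"
    using iso_to_direct_summand_split[OF bimodule_E M N] by blast
  note simps = bimodule_power_simps regular_bimodule_def
  note \<phi>h = bimodule_homD[OF \<phi>] and \<psi>h = bimodule_homD[OF \<psi>]
  let ?one = "pt \<one>\<^bsub>A\<^esub> \<one>\<^bsub>A\<^esub>"
  define r where "r = \<phi> ?one"
  define u where "u i = (\<lambda>k\<in>{..<N}. if k = i then \<one>\<^bsub>A\<^esub> else \<zero>\<^bsub>A\<^esub>)" for i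
  define e where "e i = \<psi> (u i)" for i
  have u: "u i \<in> carrier ?M" for i by (simp add: u_def simps restrict_PiE_iff)
  have r: "r \<in> carrier ?M" unfolding r_def by (rule \<phi>h) simp
  then have r1: "r i \<in> carrier A" if "i < N" for i using that by (auto simp: simps)
  have r2: "\<rho> c \<otimes>\<^bsub>A\<^esub> r i = r i \<otimes>\<^bsub>A\<^esub> \<rho> c" if "i < N" "c \<in> carrier R" for i c
  proof -
    have "lact ?M (\<rho> c) r = ract ?M r (\<rho> c)"
      unfolding r_def using that one_central by (simp add: ext_centralizer_iff flip: \<phi>h(3,4))
    then have "lact ?M (\<rho> c) r i = ract ?M r (\<rho> c) i" by simp
    then show ?thesis using that by (simp add: simps)
  qed
  have "lact ?M a (u i) = ract ?M (u i) a" if "a \<in> carrier A" for a i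
    using that by (auto simp: u_def simps fun_eq_iff)
  then have e: "e i \<in> ext_centralizer A R \<rho> A id" for i
    using u by (simp add: ext_centralizer_iff e_def \<psi>h(1) flip: \<psi>h(3,4))
  \<comment> \<open>\<open>t k\<close> keeps the first \<open>k\<close> coordinates of
    \<open>r\<close>, so that the expansion of \<open>\<psi> r\<close> can be proved by adding one
    unit vector at a time.\<close>
  define t where "t k = (\<lambda>i\<in>{..<N}. if i < k then r i else \<zero>\<^bsub>A\<^esub>)" for k
  have t: "t k \<in> carrier ?M" for k using r1 by (simp add: t_def simps restrict_PiE_iff)
  have "\<psi> (t k) = (\<Oplus>\<^bsub>E\<^esub>i\<in>{..<k}. lact E (r i) (e i))" if "k \<le> N" for k
    using that
  proof (induction k)
    case 0
    have "t 0 = \<zero>\<^bsub>?M\<^esub>" by (simp add: t_def simps)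
    moreover have "\<psi> \<zero>\<^bsub>?M\<^esub> = \<zero>\<^bsub>E\<^esub>"
      by (rule abelian_group_hom.hom_zero[OF bimodule_hom_abelian[OF \<psi>]])
        (rule M.abelian_group_axioms B.abelian_group_axioms)+
    ultimately show ?case by simp
  next
    case (Suc k)
    have le: "lact E (r i) (e i) \<in> carrier E" if "i < Suc k" for i
      using that Suc.prems by (intro B.lact_closed r1) (simp_all add: e_def \<psi>h(1) u)
    have "t (Suc k) = lact ?M (r k) (u k) \<oplus>\<^bsub>?M\<^esub> t k"
      using Suc.prems r1 by (auto simp: t_def u_def simps fun_eq_iff less_Suc_eq)
    then have "\<psi> (t (Suc k)) = lact E (r k) (e k) \<oplus>\<^bsub>E\<^esub> (\<Oplus>\<^bsub>E\<^esub>i\<in>{..<k}. lact E (r i) (e i))"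
      using Suc by (simp add: \<psi>h(2,3) t u r1 M.lact_closed e_def)
    also have "\<dots> = (\<Oplus>\<^bsub>E\<^esub>i\<in>{..<Suc k}. lact E (r i) (e i))"
      unfolding lessThan_Suc by (subst B.finsum_insert) (use le in auto)
    finally show ?case .
  qed
  \<comment> \<open>Outside the index range both functions are \<open>undefined\<close> by
    extensionality.\<close>
  moreover have "t N = r"
  proof (rule ext)
    have rE: "r \<in> {..<N} \<rightarrow>\<^sub>E carrier A" using r by (simp add: simps)
    show "t N i = r i" for i using PiE_arb[OF rE, of i] by (simp add: t_def)
  qed
  moreover have "\<psi> r = ?one" unfolding r_def by (rule split) simp
  ultimately have "?one = (\<Oplus>\<^bsub>E\<^esub>i\<in>{..<N}. lact E (r i) (e i))"
    by (metis order_refl)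
  then show thesis using that r1 r2 e by blast
qed

text \<open>At \<open>v = 1\<close> this is the multiplication map
  \<open>A \<otimes>\<^sub>R A \<rightarrow> A\<close>; a separability element is an element
  commuting with \<open>A\<close> whose product is \<open>1\<close>.\<close>

lemma ext_map_regular:
  assumes "v \<in> carrier A" "\<And>c. c \<in> carrier R \<Longrightarrow> \<rho> c \<otimes>\<^bsub>A\<^esub> v = v \<otimes>\<^bsub>A\<^esub> \<rho> c"
  shows "abelian_group_hom E A (ext_map (regular_bimodule A) v)"
    and "\<lbrakk>a \<in> carrier A; z \<in> carrier E\<rbrakk>
      \<Longrightarrow> ext_map (regular_bimodule A) v (lact E a z) = a \<otimes>\<^bsub>A\<^esub> ext_map (regular_bimodule A) v z"
    and "\<lbrakk>a \<in> carrier A; z \<in> carrier E\<rbrakk>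
      \<Longrightarrow> ext_map (regular_bimodule A) v (ract E z a) = ext_map (regular_bimodule A) v z \<otimes>\<^bsub>A\<^esub> a"
    and "\<lbrakk>x \<in> carrier A; y \<in> carrier A\<rbrakk>
      \<Longrightarrow> ext_map (regular_bimodule A) v (pt x y) = x \<otimes>\<^bsub>A\<^esub> (v \<otimes>\<^bsub>A\<^esub> y)"
proof -
  have sel: "carrier (regular_bimodule A) = carrier A" "ring.add (regular_bimodule A) = ring.add A"
    "lact (regular_bimodule A) = monoid.mult A" "ract (regular_bimodule A) = monoid.mult A"
    by (simp_all add: regular_bimodule_def)
  have "ext_map (regular_bimodule A) v \<in> bimodule_hom A A E (regular_bimodule A)"
    by (rule ext_map_hom[OF S.bimodule_regular]) (simp_all add: sel assms)
  note h = bimodule_homD[OF this, unfolded sel]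
  show "abelian_group_hom E A (ext_map (regular_bimodule A) v)"
    by (rule additive_homI) (simp_all add: B.abelian_group_axioms S.abelian_group_axioms h(1,2))
  show "\<lbrakk>a \<in> carrier A; z \<in> carrier E\<rbrakk>
      \<Longrightarrow> ext_map (regular_bimodule A) v (lact E a z) = a \<otimes>\<^bsub>A\<^esub> ext_map (regular_bimodule A) v z"
    and "\<lbrakk>a \<in> carrier A; z \<in> carrier E\<rbrakk>
      \<Longrightarrow> ext_map (regular_bimodule A) v (ract E z a) = ext_map (regular_bimodule A) v z \<otimes>\<^bsub>A\<^esub> a"
    by (rule h; assumption)+
  show "\<lbrakk>x \<in> carrier A; y \<in> carrier A\<rbrakk>
      \<Longrightarrow> ext_map (regular_bimodule A) v (pt x y) = x \<otimes>\<^bsub>A\<^esub> (v \<otimes>\<^bsub>A\<^esub> y)"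
    using ext_map_pt[OF S.bimodule_regular, of v x y] assms by (simp add: sel)
qed

text \<open>Writing \<open>1 \<otimes> 1 = \<Sum> r\<^sub>i e\<^sub>i\<close>, every \<open>v\<close> in the centralizer of \<open>R\<close> equals \<open>\<Sum> r\<^sub>i (e\<^sub>i\<^sup>1 v e\<^sub>i\<^sup>2)\<close>, so the
  \<open>r\<^sub>i\<close> generate the centralizer \<open>V\<close> over the centre. The products \<open>e\<^sup>1 e\<^sup>2\<close> of central elements form an
  ideal \<open>J\<close> of the centre with \<open>V = V J\<close>, and Nakayama's lemma shows \<open>1 \<in> J\<close>.\<close>

lemma H_separable_separable:
  assumes "H_separable A R \<rho>"
  obtains e where "e \<in> ext_centralizer A R \<rho> A id" "ext_map (regular_bimodule A) \<one>\<^bsub>A\<^esub> e = \<one>\<^bsub>A\<^esub>"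
proof -
  obtain N :: nat and r e where r: "\<And>i. i < N \<Longrightarrow> r i \<in> carrier A"
    and rc: "\<And>i c. i < N \<Longrightarrow> c \<in> carrier R \<Longrightarrow> \<rho> c \<otimes>\<^bsub>A\<^esub> r i = r i \<otimes>\<^bsub>A\<^esub> \<rho> c"
    and e: "\<And>i. i < N \<Longrightarrow> e i \<in> ext_centralizer A R \<rho> A id"
    and one: "pt \<one>\<^bsub>A\<^esub> \<one>\<^bsub>A\<^esub> = (\<Oplus>\<^bsub>E\<^esub>i\<in>{..<N}. lact E (r i) (e i))"
    using H_separable_elements[OF assms] by blast
  define f where "f = ext_map (regular_bimodule A)"
  define V where "V = {v \<in> carrier A. \<forall>c \<in> carrier R. \<rho> c \<otimes>\<^bsub>A\<^esub> v = v \<otimes>\<^bsub>A\<^esub> \<rho> c}"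
  define Z where "Z = ext_centralizer A R \<rho> A id"
  have V: "v \<in> carrier A" if "v \<in> V" for v using that by (simp add: V_def)
  have ZE: "z \<in> carrier E" if "z \<in> Z" for z using that by (simp add: Z_def ext_centralizer_iff)
  have Zc: "lact E a z = ract E z a" if "z \<in> Z" "a \<in> carrier A" for z a
    using that by (simp add: Z_def ext_centralizer_iff)
  have hom: "abelian_group_hom E A (f v)"
    and lact: "\<And>a z. \<lbrakk>a \<in> carrier A; z \<in> carrier E\<rbrakk> \<Longrightarrow> f v (lact E a z) = a \<otimes>\<^bsub>A\<^esub> f v z"
    and ract: "\<And>a z. \<lbrakk>a \<in> carrier A; z \<in> carrier E\<rbrakk> \<Longrightarrow> f v (ract E z a) = f v z \<otimes>\<^bsub>A\<^esub> a"
    and f_one: "f v (pt \<one>\<^bsub>A\<^esub> \<one>\<^bsub>A\<^esub>) = v" if "v \<in> V" for v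
    using ext_map_regular[of v] that by (simp_all add: f_def V_def)
  have f_cl: "f v z \<in> carrier A" if "v \<in> V" "z \<in> carrier E" for v z
    using abelian_group_hom.hom_closed[OF hom] that by simp
  have f_central: "a \<otimes>\<^bsub>A\<^esub> f v z = f v z \<otimes>\<^bsub>A\<^esub> a" if "v \<in> V" "z \<in> Z" "a \<in> carrier A" for v z a
    using that Zc ZE by (metis lact ract)
  have expand: "v = (\<Oplus>\<^bsub>A\<^esub>i\<in>{..<N}. r i \<otimes>\<^bsub>A\<^esub> f v (e i))" if "v \<in> V" for v
  \<comment> \<open>Apply \<open>f v\<close> to the expansion of \<open>1 \<otimes> 1\<close>; its
    value at \<open>1 \<otimes> 1\<close> is \<open>v\<close>.\<close>
  proof -
    have "v = f v (\<Oplus>\<^bsub>E\<^esub>i\<in>{..<N}. lact E (r i) (e i))" using f_one[OF that] by (simp add: one)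
    also have "\<dots> = (\<Oplus>\<^bsub>A\<^esub>i\<in>{..<N}. f v (lact E (r i) (e i)))"
      by (rule abelian_group_hom_finsum[OF hom[OF that]])
        (use r e ZE in \<open>auto intro!: B.lact_closed simp: Z_def\<close>)
    also have "\<dots> = (\<Oplus>\<^bsub>A\<^esub>i\<in>{..<N}. r i \<otimes>\<^bsub>A\<^esub> f v (e i))"
      by (rule S.finsum_cong') (use r e ZE that f_cl in \<open>auto simp: Z_def lact\<close>)
    finally show ?thesis .
  qed
  have oneV: "\<one>\<^bsub>A\<^esub> \<in> V" by (simp add: V_def)
  have rV: "r i \<in> V" if "i < N" for i using r rc that by (simp add: V_def)
  have eZ: "e i \<in> Z" if "i < N" for i using e that by (simp add: Z_def)
  have V_mult: "v \<otimes>\<^bsub>A\<^esub> w \<in> V" if "v \<in> V" "w \<in> V" for v w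
    using that by (simp add: V_def) (metis S.m_assoc hom_closed_A)
  define J where "J = f \<one>\<^bsub>A\<^esub> ` Z"
  have J_cl: "J \<subseteq> carrier A" using f_cl[OF oneV] ZE by (auto simp: J_def)
  \<comment> \<open>Viewing \<open>A\<close> as an extension of itself makes the closure lemmas for
    centralizers available for \<open>Z\<close>.\<close>
  have id: "ring_extension A A id"
    by (intro ring_extension.intro ring_hom_ring.intro ring_hom_ring_axioms.intro S.ring_axioms)
      (auto intro: ring_hom_memI)
  note f1 = abelian_group_hom.hom_add[OF hom[OF oneV]] abelian_group_hom.hom_zero[OF hom[OF oneV]]
    abelian_group_hom.hom_a_inv[OF hom[OF oneV]]
  note central = central_zero[OF id, folded Z_def] central_add[OF id, folded Z_def] central_minus[OF id, folded Z_def]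
  have J0: "\<zero>\<^bsub>A\<^esub> \<in> J" unfolding J_def using f1(2) central(1) by (metis imageI)
  have J_add: "x \<oplus>\<^bsub>A\<^esub> y \<in> J" if "x \<in> J" "y \<in> J" for x y
    using that central(2) ZE by (auto simp: J_def simp flip: f1(1) intro!: imageI)
  have J_minus: "\<ominus>\<^bsub>A\<^esub> x \<in> J" if "x \<in> J" for x
    using that central(3) ZE by (auto simp: J_def simp flip: f1(3) intro!: imageI)
  have J_ideal: "x \<otimes>\<^bsub>A\<^esub> j \<in> J" if x: "x \<in> carrier A" "\<And>a. a \<in> carrier A \<Longrightarrow> a \<otimes>\<^bsub>A\<^esub> x = x \<otimes>\<^bsub>A\<^esub> a" and j: "j \<in> J" for x j
  proof -
    obtain z where z: "z \<in> Z" "j = f \<one>\<^bsub>A\<^esub> z" using j by (auto simp: J_def)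
    have "lact E x z \<in> Z"
    proof -
      have "lact E a (lact E x z) = ract E (lact E x z) a" if a: "a \<in> carrier A" for a
      proof -
        have "lact E a (lact E x z) = lact E (a \<otimes>\<^bsub>A\<^esub> x) z" using a x(1) z ZE by (simp add: B.lact_mult)
        also have "\<dots> = lact E x (lact E a z)" unfolding x(2)[OF a] using a x(1) z ZE by (simp add: B.lact_mult)
        also have "lact E a z = ract E z a" using a z by (simp add: Zc)
        finally show ?thesis using a x(1) z ZE by (simp add: B.lact_ract)
      qed
      then show ?thesis using x(1) z by (simp add: Z_def ext_centralizer_iff B.lact_closed B.ract_closed)
    qed
    then show ?thesis using lact[OF oneV x(1) ZE[OF z(1)]] z by (metis J_def imageI)
  qed
  have J_central: "a \<otimes>\<^bsub>A\<^esub> j = j \<otimes>\<^bsub>A\<^esub> a" if "j \<in> J" "a \<in> carrier A" for a j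
    using that f_central[OF oneV] by (auto simp: J_def)
  have J_sum: "(\<Oplus>\<^bsub>A\<^esub>k\<in>{..<m}. g k) \<in> J" if "\<And>k. k < m \<Longrightarrow> g k \<in> J" for g and m :: nat
    using that
  proof (induction m)
    case (Suc m)
    then show ?case
      unfolding lessThan_Suc by (subst S.finsum_insert) (use J_cl J_add in auto)
  qed (simp add: J0)
  \<comment> \<open>Expand \<open>1 = \<Sum> r k f 1 (e k)\<close>, multiply by \<open>r i\<close>,
    and expand \<open>r i r k\<close> over the \<open>r l\<close>; then \<open>a i l\<close> is the
    coefficient of \<open>r l\<close>. It lies in \<open>J\<close> since
    \<open>f (r i r k) (e l)\<close> is central in \<open>A\<close> and each
    \<open>f 1 (e k)\<close> is in \<open>J\<close>.\<close>
  define a where "a i l = (\<Oplus>\<^bsub>A\<^esub>k\<in>{..<N}. f (r i \<otimes>\<^bsub>A\<^esub> r k) (e l) \<otimes>\<^bsub>A\<^esub> f \<one>\<^bsub>A\<^esub> (e k))" for i l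
  have aJ: "a i l \<in> J" if "i < N" "l < N" for i l
    unfolding a_def
    by (intro J_sum J_ideal f_cl V_mult f_central) (use that in \<open>auto simp: rV eZ ZE J_def\<close>)
  have r_eq: "r i = (\<Oplus>\<^bsub>A\<^esub>l\<in>{..<N}. r l \<otimes>\<^bsub>A\<^esub> a i l)" if i: "i < N" for i
  proof -
    have fik: "f (r i \<otimes>\<^bsub>A\<^esub> r k) (e l) \<in> carrier A" "f \<one>\<^bsub>A\<^esub> (e k) \<in> carrier A" if "k < N" "l < N" for k l
      using that i rV eZ ZE V_mult oneV by (auto intro!: f_cl)
    have fi1: "f \<one>\<^bsub>A\<^esub> (e k) \<in> carrier A" if "k < N" for k using fik(2)[OF that that] .
    note cl = fik(1) fi1 r
    have "r i = r i \<otimes>\<^bsub>A\<^esub> (\<Oplus>\<^bsub>A\<^esub>k\<in>{..<N}. r k \<otimes>\<^bsub>A\<^esub> f \<one>\<^bsub>A\<^esub> (e k))"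
      using expand[OF oneV] r[OF i] S.r_one[of "r i"] by metis
    also have "\<dots> = (\<Oplus>\<^bsub>A\<^esub>k\<in>{..<N}. r i \<otimes>\<^bsub>A\<^esub> (r k \<otimes>\<^bsub>A\<^esub> f \<one>\<^bsub>A\<^esub> (e k)))"
      by (rule S.finsum_rdistr) (use cl i in auto)
    also have "\<dots> = (\<Oplus>\<^bsub>A\<^esub>k\<in>{..<N}. \<Oplus>\<^bsub>A\<^esub>l\<in>{..<N}. r l \<otimes>\<^bsub>A\<^esub> (f (r i \<otimes>\<^bsub>A\<^esub> r k) (e l) \<otimes>\<^bsub>A\<^esub> f \<one>\<^bsub>A\<^esub> (e k)))"
    proof (rule S.finsum_cong')
      fix k assume "k \<in> {..<N}"
      then have k: "k < N" by simp
      have "r i \<otimes>\<^bsub>A\<^esub> (r k \<otimes>\<^bsub>A\<^esub> f \<one>\<^bsub>A\<^esub> (e k)) = (r i \<otimes>\<^bsub>A\<^esub> r k) \<otimes>\<^bsub>A\<^esub> f \<one>\<^bsub>A\<^esub> (e k)"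
        using cl i k by (simp add: S.m_assoc)
      also have "r i \<otimes>\<^bsub>A\<^esub> r k = (\<Oplus>\<^bsub>A\<^esub>l\<in>{..<N}. r l \<otimes>\<^bsub>A\<^esub> f (r i \<otimes>\<^bsub>A\<^esub> r k) (e l))"
        by (rule expand) (use V_mult rV i k in simp)
      also have "\<dots> \<otimes>\<^bsub>A\<^esub> f \<one>\<^bsub>A\<^esub> (e k) = (\<Oplus>\<^bsub>A\<^esub>l\<in>{..<N}. r l \<otimes>\<^bsub>A\<^esub> f (r i \<otimes>\<^bsub>A\<^esub> r k) (e l) \<otimes>\<^bsub>A\<^esub> f \<one>\<^bsub>A\<^esub> (e k))"
        by (rule S.finsum_ldistr) (use cl k in auto)
      also have "\<dots> = (\<Oplus>\<^bsub>A\<^esub>l\<in>{..<N}. r l \<otimes>\<^bsub>A\<^esub> (f (r i \<otimes>\<^bsub>A\<^esub> r k) (e l) \<otimes>\<^bsub>A\<^esub> f \<one>\<^bsub>A\<^esub> (e k)))"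
        by (rule S.finsum_cong') (use cl k in \<open>auto simp: S.m_assoc\<close>)
      finally show "r i \<otimes>\<^bsub>A\<^esub> (r k \<otimes>\<^bsub>A\<^esub> f \<one>\<^bsub>A\<^esub> (e k))
        = (\<Oplus>\<^bsub>A\<^esub>l\<in>{..<N}. r l \<otimes>\<^bsub>A\<^esub> (f (r i \<otimes>\<^bsub>A\<^esub> r k) (e l) \<otimes>\<^bsub>A\<^esub> f \<one>\<^bsub>A\<^esub> (e k)))" .
    qed (use cl in \<open>auto intro!: S.finsum_closed\<close>)
    also have "\<dots> = (\<Oplus>\<^bsub>A\<^esub>l\<in>{..<N}. \<Oplus>\<^bsub>A\<^esub>k\<in>{..<N}. r l \<otimes>\<^bsub>A\<^esub> (f (r i \<otimes>\<^bsub>A\<^esub> r k) (e l) \<otimes>\<^bsub>A\<^esub> f \<one>\<^bsub>A\<^esub> (e k)))"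
      by (rule S.finsum_finsum_swap) (use cl in auto)
    also have "\<dots> = (\<Oplus>\<^bsub>A\<^esub>l\<in>{..<N}. r l \<otimes>\<^bsub>A\<^esub> a i l)"
      unfolding a_def
      by (rule S.finsum_cong', simp_all) (use cl in \<open>auto intro!: S.finsum_closed S.finsum_rdistr[symmetric]\<close>)
    finally show ?thesis .
  qed
  have J_mult: "x \<otimes>\<^bsub>A\<^esub> y \<in> J" if "x \<in> J" "y \<in> J" for x y
    by (rule J_ideal) (use that J_cl J_central in auto)
  have "\<exists>j \<in> J. \<forall>i < N. r i \<otimes>\<^bsub>A\<^esub> j = r i"
    by (rule S.central_nakayama[OF J_cl J0 J_add J_minus J_mult J_central[symmetric] r aJ r_eq])
  then obtain j where j: "j \<in> J" "\<And>i. i < N \<Longrightarrow> r i \<otimes>\<^bsub>A\<^esub> j = r i" by blast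
  have jA: "j \<in> carrier A" using j J_cl by auto
  \<comment> \<open>The central \<open>j\<close> is moved next to each \<open>r i\<close>, where it
    is absorbed: \<open>j = \<Sum> r i f 1 (e i) j = \<Sum> r i f 1 (e i) = 1\<close>.\<close>
  have "j = (\<Oplus>\<^bsub>A\<^esub>i\<in>{..<N}. r i \<otimes>\<^bsub>A\<^esub> f \<one>\<^bsub>A\<^esub> (e i)) \<otimes>\<^bsub>A\<^esub> j"
    using expand[OF oneV] jA S.l_one[of j] by metis
  also have "\<dots> = (\<Oplus>\<^bsub>A\<^esub>i\<in>{..<N}. r i \<otimes>\<^bsub>A\<^esub> f \<one>\<^bsub>A\<^esub> (e i) \<otimes>\<^bsub>A\<^esub> j)"
    by (rule S.finsum_ldistr) (use jA r f_cl[OF oneV] ZE eZ in auto)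
  also have "\<dots> = (\<Oplus>\<^bsub>A\<^esub>i\<in>{..<N}. r i \<otimes>\<^bsub>A\<^esub> f \<one>\<^bsub>A\<^esub> (e i))"
  proof (rule S.finsum_cong')
    fix i assume "i \<in> {..<N}"
    then have i: "i < N" by simp
    have fi: "f \<one>\<^bsub>A\<^esub> (e i) \<in> carrier A" using f_cl[OF oneV] ZE eZ i by blast
    have "r i \<otimes>\<^bsub>A\<^esub> f \<one>\<^bsub>A\<^esub> (e i) \<otimes>\<^bsub>A\<^esub> j = r i \<otimes>\<^bsub>A\<^esub> j \<otimes>\<^bsub>A\<^esub> f \<one>\<^bsub>A\<^esub> (e i)"
      using fi jA r[OF i] J_central[OF j(1) fi] by (simp add: S.m_assoc)
    then show "r i \<otimes>\<^bsub>A\<^esub> f \<one>\<^bsub>A\<^esub> (e i) \<otimes>\<^bsub>A\<^esub> j = r i \<otimes>\<^bsub>A\<^esub> f \<one>\<^bsub>A\<^esub> (e i)" using j(2)[OF i] by simp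
  qed (use r f_cl[OF oneV] ZE eZ in auto)
  also have "\<dots> = \<one>\<^bsub>A\<^esub>" by (rule expand[OF oneV, symmetric])
  finally have "\<one>\<^bsub>A\<^esub> \<in> J" using j by simp
  then obtain z where "z \<in> Z" "f \<one>\<^bsub>A\<^esub> z = \<one>\<^bsub>A\<^esub>" by (auto simp: J_def)
  then show thesis using that by (simp add: f_def Z_def)
qed

end
section \<open>The tower\<close>

context ring_tower
begin

sublocale AB: ring_extension A B \<alpha>
  by (intro ring_extension.intro ring_hom_ring.intro ring_hom_ring_axioms.intro A.ring_axioms B.ring_axioms top_hom)

sublocale BC: ring_extension B C \<beta>
  by (intro ring_extension.intro ring_hom_ring.intro ring_hom_ring_axioms.intro B.ring_axioms C.ring_axioms bottom_hom)

sublocale AC: ring_extension A C "\<alpha> \<circ> \<beta>"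
  by (intro ring_extension.intro ring_hom_ring.intro ring_hom_ring_axioms.intro A.ring_axioms C.ring_axioms
      ring_hom_trans[OF bottom_hom top_hom])

abbreviation (input) EAB where "EAB \<equiv> ext_tensor A B \<alpha>"
abbreviation (input) EAC where "EAC \<equiv> ext_tensor A C (\<alpha> \<circ> \<beta>)"
abbreviation (input) EBC where "EBC \<equiv> ext_tensor B C \<beta>"
abbreviation (input) oneAB where "oneAB \<equiv> ext_pure A B \<alpha> \<one>\<^bsub>A\<^esub> \<one>\<^bsub>A\<^esub>"
abbreviation (input) oneAC where "oneAC \<equiv> ext_pure A C (\<alpha> \<circ> \<beta>) \<one>\<^bsub>A\<^esub> \<one>\<^bsub>A\<^esub>"
abbreviation (input) oneBC where "oneBC \<equiv> ext_pure B C \<beta> \<one>\<^bsub>B\<^esub> \<one>\<^bsub>B\<^esub>"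

text \<open>The map \<open>B \<otimes>\<^sub>C B \<rightarrow> A \<otimes>\<^sub>C A\<close> induced by \<open>\<alpha>\<close>.\<close>

definition base_map where
  "base_map = ext_map (restrict_scalars \<alpha> \<alpha> EAC) oneAC"

text \<open>When \<open>A \<otimes>\<^sub>C A\<close> is viewed as a bimodule over \<open>B\<close>
  along \<open>\<alpha>\<close>, its element \<open>1 \<otimes> 1\<close> still centralizes
  \<open>C\<close>, so the universal property of \<open>B \<otimes>\<^sub>C B\<close>
  applies.\<close>

lemma base_map:
  shows base_map_closed: "z \<in> carrier EBC \<Longrightarrow> base_map z \<in> carrier EAC"
    and base_map_add: "\<lbrakk>z \<in> carrier EBC; w \<in> carrier EBC\<rbrakk>
      \<Longrightarrow> base_map (z \<oplus>\<^bsub>EBC\<^esub> w) = base_map z \<oplus>\<^bsub>EAC\<^esub> base_map w"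
    and base_map_lact: "\<lbrakk>b \<in> carrier B; z \<in> carrier EBC\<rbrakk> \<Longrightarrow> base_map (lact EBC b z) = lact EAC (\<alpha> b) (base_map z)"
    and base_map_ract: "\<lbrakk>b \<in> carrier B; z \<in> carrier EBC\<rbrakk> \<Longrightarrow> base_map (ract EBC z b) = ract EAC (base_map z) (\<alpha> b)"
    and base_map_pure: "\<lbrakk>x \<in> carrier B; y \<in> carrier B\<rbrakk>
      \<Longrightarrow> base_map (ext_pure B C \<beta> x y) = lact EAC (\<alpha> x) (ract EAC oneAC (\<alpha> y))"
    and base_map_one: "base_map oneBC = oneAC"
proof -
  let ?M = "restrict_scalars \<alpha> \<alpha> EAC"
  have sel: "carrier ?M = carrier EAC" "ring.add ?M = ring.add EAC"
    "lact ?M b z = lact EAC (\<alpha> b) z" "ract ?M z b = ract EAC z (\<alpha> b)" for b z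
    by (simp_all add: restrict_scalars_def)
  have M: "bimodule B B ?M"
    by (rule bimodule_restrict_scalars[OF AC.bimodule_E B.ring_axioms B.ring_axioms top_hom top_hom])
  have cen: "lact ?M (\<beta> c) oneAC = ract ?M oneAC (\<beta> c)" if "c \<in> carrier C" for c
    using AC.one_central that by (simp add: sel ext_centralizer_iff)
  have one: "oneAC \<in> carrier ?M" by (simp add: sel)
  note h = bimodule_homD[OF BC.ext_map_hom[OF M one cen], unfolded sel, folded base_map_def]
  show "z \<in> carrier EBC \<Longrightarrow> base_map z \<in> carrier EAC"
    and "\<lbrakk>z \<in> carrier EBC; w \<in> carrier EBC\<rbrakk> \<Longrightarrow> base_map (z \<oplus>\<^bsub>EBC\<^esub> w) = base_map z \<oplus>\<^bsub>EAC\<^esub> base_map w"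
    and "\<lbrakk>b \<in> carrier B; z \<in> carrier EBC\<rbrakk> \<Longrightarrow> base_map (lact EBC b z) = lact EAC (\<alpha> b) (base_map z)"
    and "\<lbrakk>b \<in> carrier B; z \<in> carrier EBC\<rbrakk> \<Longrightarrow> base_map (ract EBC z b) = ract EAC (base_map z) (\<alpha> b)"
    by (rule h; assumption)+
  show "\<lbrakk>x \<in> carrier B; y \<in> carrier B\<rbrakk>
      \<Longrightarrow> base_map (ext_pure B C \<beta> x y) = lact EAC (\<alpha> x) (ract EAC oneAC (\<alpha> y))"
    using BC.ext_map_pt[OF M one cen, of x y] by (simp add: sel base_map_def)
  show "base_map oneBC = oneAC"
    using BC.ext_map_one[OF M one cen] by (simp add: base_map_def)
qed

lemma base_map_hom: "abelian_group_hom EBC EAC base_map"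
  by (rule additive_homI[OF BC.B.abelian_group_axioms AC.B.abelian_group_axioms base_map_closed base_map_add])

text \<open>Supplies elements of \<open>Q\<close>: linearity of \<open>base_map\<close> over
  \<open>B\<close> transports commutation with \<open>B\<close>.\<close>

lemma base_map_central:
  "z \<in> ext_centralizer B C \<beta> B id \<Longrightarrow> base_map z \<in> ext_centralizer A C (\<alpha> \<circ> \<beta>) B \<alpha>"
  by (simp add: ext_centralizer_iff base_map_closed flip: base_map_lact base_map_ract)

lemma oneAB_central: "oneAB \<in> ext_centralizer A B \<alpha> C (\<alpha> \<circ> \<beta>)"
  using AB.one_central by (simp add: ext_centralizer_iff)

text \<open>Supplies elements of \<open>P\<close>: for \<open>r\<close> commuting with
  \<open>C\<close>, \<open>c r \<otimes> 1 = r c \<otimes> 1 = r \<otimes> c\<close>, the last step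
  because \<open>c\<close> acts through \<open>B\<close>.\<close>

lemma lact_oneAB_central:
  assumes "r \<in> carrier B" "\<And>c. c \<in> carrier C \<Longrightarrow> \<beta> c \<otimes>\<^bsub>B\<^esub> r = r \<otimes>\<^bsub>B\<^esub> \<beta> c"
  shows "lact EAB (\<alpha> r) oneAB \<in> ext_centralizer A B \<alpha> C (\<alpha> \<circ> \<beta>)"
proof -
  have "lact EAB (\<alpha> (\<beta> c)) (lact EAB (\<alpha> r) oneAB) = ract EAB (lact EAB (\<alpha> r) oneAB) (\<alpha> (\<beta> c))"
    if c: "c \<in> carrier C" for c
  proof -
    have "lact EAB (\<alpha> (\<beta> c)) (lact EAB (\<alpha> r) oneAB) = lact EAB (\<alpha> (\<beta> c \<otimes>\<^bsub>B\<^esub> r)) oneAB"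
      using c assms(1) by (simp add: AB.B.lact_mult)
    also have "\<dots> = lact EAB (\<alpha> r) (lact EAB (\<alpha> (\<beta> c)) oneAB)"
      unfolding assms(2)[OF c] using c assms(1) by (simp add: AB.B.lact_mult)
    also have "lact EAB (\<alpha> (\<beta> c)) oneAB = ract EAB oneAB (\<alpha> (\<beta> c))"
      using oneAB_central c by (simp add: ext_centralizer_iff)
    finally show ?thesis using c assms(1) by (simp add: AB.B.lact_ract)
  qed
  then show ?thesis using assms(1) by (simp add: ext_centralizer_iff AB.B.lact_closed)
qed

text \<open>Pairing with \<open>1 \<otimes> 1\<close> sends \<open>x \<otimes>\<^sub>C y\<close> to
  \<open>x \<otimes>\<^sub>B y\<close>. For \<open>x\<close> and \<open>y\<close> coming from
  \<open>B\<close> this is \<open>x y \<otimes>\<^sub>B 1\<close>, so only the product of the tensor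
  matters.\<close>

lemma nested_mult_oneAB_base_map:
  assumes "z \<in> carrier EBC"
  shows "nested_mult A B \<alpha> oneAB (base_map z) = lact EAB (\<alpha> (ext_map (regular_bimodule B) \<one>\<^bsub>B\<^esub> z)) oneAB"
proof -
  note n = bimodule_homD[OF AB.nested_mult_hom[OF AC.ring_extension_axioms oneAB_central]]
  let ?m = "ext_map (regular_bimodule B) \<one>\<^bsub>B\<^esub>"
  have one: "\<one>\<^bsub>B\<^esub> \<in> carrier B" "\<And>c. c \<in> carrier C \<Longrightarrow> \<beta> c \<otimes>\<^bsub>B\<^esub> \<one>\<^bsub>B\<^esub> = \<one>\<^bsub>B\<^esub> \<otimes>\<^bsub>B\<^esub> \<beta> c"
    by simp_all
  note m = abelian_group_hom.hom_closed[OF BC.ext_map_regular(1)[OF one]]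
    abelian_group_hom.hom_add[OF BC.ext_map_regular(1)[OF one]] BC.ext_map_regular(4)[OF one]
  show ?thesis
    using assms
  proof (induction z rule: BC.ext_induct)
    case (pure x y)
    have "nested_mult A B \<alpha> oneAB (base_map (ext_pure B C \<beta> x y)) = lact EAB (\<alpha> x) (ract EAB oneAB (\<alpha> y))"
      using pure by (simp add: base_map_pure n(3,4) AC.B.ract_closed
          AB.nested_mult_one[OF AC.ring_extension_axioms oneAB_central])
    also have "\<dots> = lact EAB (\<alpha> x) (lact EAB (\<alpha> y) oneAB)"
      using AB.one_central pure by (simp add: ext_centralizer_iff)
    finally show ?case using pure by (simp add: m AB.B.lact_mult)
  next
    case (add x y)
    then show ?case by (simp add: base_map_add base_map_closed n(2) m AB.B.lact_add_left)
  qed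
qed

section \<open>The units of \<open>T\<close> and \<open>U\<close> as values of the Morita
  maps\<close>

abbreviation (input) T where "T \<equiv> centralizer_ring A B \<alpha>"
abbreviation (input) U where "U \<equiv> centralizer_ring A C (\<alpha> \<circ> \<beta>)"
abbreviation (input) P where "P \<equiv> centralizer_bimodule A B \<alpha> C (\<alpha> \<circ> \<beta>)"
abbreviation (input) Q where "Q \<equiv> centralizer_bimodule A C (\<alpha> \<circ> \<beta>) B \<alpha>"
abbreviation (input) \<mu> where "\<mu> \<equiv> tensor_lift T (nested_mult A B \<alpha>)"
abbreviation (input) \<nu> where "\<nu> \<equiv> tensor_lift U (nested_mult A C (\<alpha> \<circ> \<beta>))"

lemma one_in_image_\<mu>:
  assumes "H_separable B C \<beta>"
  shows "\<exists>z \<in> carrier (tensor U P Q). \<mu> z = \<one>\<^bsub>T\<^esub>"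
proof -
  obtain e where e: "e \<in> ext_centralizer B C \<beta> B id" "ext_map (regular_bimodule B) \<one>\<^bsub>B\<^esub> e = \<one>\<^bsub>B\<^esub>"
    using BC.H_separable_separable[OF assms] by blast
  have P: "oneAB \<in> carrier P" and Q: "base_map e \<in> carrier Q"
    using oneAB_central base_map_central[OF e(1)]
    by (simp_all add: AB.centralizer_bimodule_simps AC.centralizer_bimodule_simps)
  interpret PQ: tensor_pair T U T P Q
    by (rule AB.tensor_pair_centralizers[OF AC.ring_extension_axioms])
  have "\<mu> (pure_tensor U P Q oneAB (base_map e)) = nested_mult A B \<alpha> oneAB (base_map e)"
    by (rule AB.lift_nested_mult_pure[OF AC.ring_extension_axioms P Q])
  also have "\<dots> = oneAB"
    using nested_mult_oneAB_base_map[of e] e by (simp add: ext_centralizer_iff AB.B.lact_one)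
  finally show ?thesis
    using PQ.pure_closed[OF P Q] by (intro bexI) (simp_all add: AB.centralizer_ring_simps)
qed

lemma one_in_image_\<nu>:
  assumes "H_separable B C \<beta>"
  shows "\<exists>z \<in> carrier (tensor T Q P). \<nu> z = \<one>\<^bsub>U\<^esub>"
proof -
  obtain N :: nat and r e where r: "\<And>i. i < N \<Longrightarrow> r i \<in> carrier B"
    and rc: "\<And>i c. i < N \<Longrightarrow> c \<in> carrier C \<Longrightarrow> \<beta> c \<otimes>\<^bsub>B\<^esub> r i = r i \<otimes>\<^bsub>B\<^esub> \<beta> c"
    and e: "\<And>i. i < N \<Longrightarrow> e i \<in> ext_centralizer B C \<beta> B id"
    and one: "oneBC = (\<Oplus>\<^bsub>EBC\<^esub>i\<in>{..<N}. lact EBC (r i) (e i))"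
    using BC.H_separable_elements[OF assms] by blast
  interpret QP: tensor_pair U T U Q P
    by (rule AC.tensor_pair_centralizers[OF AB.ring_extension_axioms])
  interpret \<nu>: abelian_group_hom "tensor T Q P" U \<nu>
    by (rule QP.tensor_lift_hom[OF _ AC.balanced_nested_mult[OF AB.ring_extension_axioms]])
      (rule ring.is_abelian_group[OF AC.ring_centralizer_ring])
  have eE: "e i \<in> carrier EBC" if "i < N" for i using e[OF that] by (simp add: ext_centralizer_iff)
  \<comment> \<open>The pair is the image of \<open>e i\<close> in \<open>Q\<close> and
    \<open>r i \<otimes> 1\<close> in \<open>P\<close>; left linearity of the product turns it into
    \<open>r i\<close> acting on the image of \<open>e i\<close>.\<close>
  have summand: "\<exists>z \<in> carrier (tensor T Q P). \<nu> z = base_map (lact EBC (r i) (e i))" if i: "i < N" for i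
  proof -
    let ?q = "base_map (e i)" and ?p = "lact EAB (\<alpha> (r i)) oneAB"
    have q: "?q \<in> ext_centralizer A C (\<alpha> \<circ> \<beta>) B \<alpha>" by (rule base_map_central[OF e[OF i]])
    have p: "?p \<in> ext_centralizer A B \<alpha> C (\<alpha> \<circ> \<beta>)" by (rule lact_oneAB_central[OF r[OF i] rc[OF i]])
    have Q: "?q \<in> carrier Q" and P: "?p \<in> carrier P"
      using p q by (simp_all add: AB.centralizer_bimodule_simps AC.centralizer_bimodule_simps)
    have "\<nu> (pure_tensor T Q P ?q ?p) = nested_mult A C (\<alpha> \<circ> \<beta>) ?q ?p"
      by (rule AC.lift_nested_mult_pure[OF AB.ring_extension_axioms Q P])
    also have "\<dots> = lact EAC (\<alpha> (r i)) ?q"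
      using bimodule_homD(3)[OF AC.nested_mult_hom[OF AB.ring_extension_axioms q], of "\<alpha> (r i)" oneAB] r[OF i]
      by (simp add: AC.nested_mult_one[OF AB.ring_extension_axioms q])
    also have "\<dots> = base_map (lact EBC (r i) (e i))"
      by (rule base_map_lact[OF r[OF i] eE[OF i], symmetric])
    finally show ?thesis using QP.pure_closed[OF Q P] by blast
  qed
  \<comment> \<open>Preimages of the summands are added one at a time; at \<open>k = N\<close> the
    sum is \<open>1 \<otimes> 1\<close>, which \<open>base_map\<close> sends to the unit of
    \<open>U\<close>.\<close>
  have "\<exists>z \<in> carrier (tensor T Q P). \<nu> z = base_map (\<Oplus>\<^bsub>EBC\<^esub>i\<in>{..<k}. lact EBC (r i) (e i))" if "k \<le> N" for k
    using that
  proof (induction k)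
    case 0
    have "\<nu> \<zero>\<^bsub>tensor T Q P\<^esub> = base_map \<zero>\<^bsub>EBC\<^esub>"
      unfolding \<nu>.hom_zero AC.centralizer_ring_simps abelian_group_hom.hom_zero[OF base_map_hom] ..
    then show ?case unfolding lessThan_0 BC.B.finsum_empty by (rule bexI) (rule QP.T.zero_closed)
  next
    case (Suc k)
    have le: "lact EBC (r i) (e i) \<in> carrier EBC" if "i < Suc k" for i
      using that Suc.prems r eE by (simp add: BC.B.lact_closed)
    obtain z where z: "z \<in> carrier (tensor T Q P)" "\<nu> z = base_map (\<Oplus>\<^bsub>EBC\<^esub>i\<in>{..<k}. lact EBC (r i) (e i))"
      using Suc.IH Suc_leD[OF Suc.prems] by blast
    obtain w where w: "w \<in> carrier (tensor T Q P)" "\<nu> w = base_map (lact EBC (r k) (e k))"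
      using summand[of k] Suc_le_lessD[OF Suc.prems] by blast
    have "(\<Oplus>\<^bsub>EBC\<^esub>i\<in>{..<Suc k}. lact EBC (r i) (e i))
        = lact EBC (r k) (e k) \<oplus>\<^bsub>EBC\<^esub> (\<Oplus>\<^bsub>EBC\<^esub>i\<in>{..<k}. lact EBC (r i) (e i))"
      unfolding lessThan_Suc by (subst BC.B.finsum_insert) (use le in auto)
    moreover have "(\<Oplus>\<^bsub>EBC\<^esub>i\<in>{..<k}. lact EBC (r i) (e i)) \<in> carrier EBC"
      by (rule BC.B.finsum_closed) (use le in auto)
    ultimately have "\<nu> (w \<oplus>\<^bsub>tensor T Q P\<^esub> z) = base_map (\<Oplus>\<^bsub>EBC\<^esub>i\<in>{..<Suc k}. lact EBC (r i) (e i))"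
      using \<nu>.hom_add[OF w(1) z(1)] z(2) w(2) le[of k] by (simp only: base_map_add AC.centralizer_ring_simps lessI)
    then show ?case by (rule bexI) (rule QP.T.a_closed[OF w(1) z(1)])
  qed
  from this[of N] show ?thesis
    by (simp only: base_map_one AC.centralizer_ring_simps order_refl one[symmetric])
qed

end

theorem proposition4p1:
  fixes A :: "('a, 'i) ring_scheme" and B :: "('b, 'j) ring_scheme" and C :: "('c, 'k) ring_scheme"
    and \<alpha> :: "'b \<Rightarrow> 'a" and \<beta> :: "'c \<Rightarrow> 'b"
  assumes tower: "ring_tower A B C \<alpha> \<beta>"
    and depth_three: "right_depth_three A B C \<alpha> \<beta>"
  shows "let \<gamma> = \<alpha> \<circ> \<beta>;
             T = centralizer_ring A B \<alpha>;
             U = centralizer_ring A C \<gamma>;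
             P = centralizer_bimodule A B \<alpha> C \<gamma>;
             Q = centralizer_bimodule A C \<gamma> B \<alpha>;
             \<mu> = tensor_lift T (\<lambda>p q. nested_mult A B \<alpha> p q);
             \<nu> = tensor_lift U (\<lambda>q p. nested_mult A C \<gamma> q p)
         in (\<forall>p \<in> carrier P. \<forall>q \<in> carrier Q. \<mu> (pure_tensor U P Q p q) = nested_mult A B \<alpha> p q) \<and>
            (\<forall>q \<in> carrier Q. \<forall>p \<in> carrier P. \<nu> (pure_tensor T Q P q p) = nested_mult A C \<gamma> q p) \<and>
            morita_context T U P Q \<mu> \<nu> \<and>
            (H_separable B C \<beta> \<longrightarrow> morita_equivalent_via T U P Q \<mu> \<nu>)"
proof -
  interpret ring_tower A B C \<alpha> \<beta> by (rule tower)
  note ctx = AB.centralizer_morita_context[OF AC.ring_extension_axioms]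
  \<comment> \<open>Both units are hit, so the bijectivity criterion applies to the context for
    \<open>\<mu>\<close> and to the swapped context for \<open>\<nu>\<close>.\<close>
  have "morita_equivalent_via T U P Q \<mu> \<nu>" if "H_separable B C \<beta>"
    unfolding morita_equivalent_via_def
    using ctx one_in_image_\<mu>[OF that] one_in_image_\<nu>[OF that] morita_context_iso[OF ctx]
      morita_context_iso[OF morita_context_swap[OF ctx]] by blast
  then show ?thesis
    unfolding Let_def
    using ctx AB.lift_nested_mult_pure[OF AC.ring_extension_axioms]
      AC.lift_nested_mult_pure[OF AB.ring_extension_axioms] by blast
qed

end
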